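(* Let $(\Lambda,\mathfrak p^\pm)$ be a linear Weingarten surface with real sphere complexes $\mathfrak p^\pm$ in a space form of non-zero curvature, rotational with respect to a non-parabolic 1-parameter subgroup of rotations $\rho^1$, and let $\{\mathfrak p^+,\mathfrak p^-,\mathfrak v_1,\mathfrak e_1,\mathfrak v_2,\mathfrak e_2\}$, $\kappa^\pm,\varepsilon,\Delta,\kappa_1,\kappa_2$ be the adapted basis of $\mathbb{R}^{4,2}$ and the constants described in the context; assume $\kappa^-\neq0$. Let $\mathfrak s^+$ be the Christoffel dual lift of the isothermic sphere congruence $s^+$ normalized by $(\mathfrak s^+,\mathfrak p^+)=0$, $(\mathfrak s^+,\mathfrak p^-)=\Delta$, and assume its $\langle\mathfrak v_2,\mathfrak e_2\rangle$-part can be written in causal polar coordinates, i.e. (in the adapted basis) $$\mathfrak s^+(\theta,t)=\rho^1_\theta\,\rho^2_{\psi(t)}\big(-\varepsilon,\ \kappa^+,\ r(t),\ 0,\ d(t),\ 0\big)^\top .$$ Then $\mathfrak s^+$ can be parametrized (by choice of the parameter $t$) such that its coordinate functions satisfy $$(r')^2=\frac{\kappa^-}{\Delta^2}(r^2-C_1)(r^2-C_2),$$ $$\psi'=\sqrt{\frac{\kappa_1\kappa_2}{\Delta}}\ \frac{\varepsilon r^2+\kappa^+C}{\kappa^+\Delta+\kappa_1r^2},$$ $$d^2=-\frac{\kappa^+\Delta+\kappa_1r^2}{\kappa_2},$$ where $C$ is the real constant of the Christoffel duality, $\mathfrak s^-_\theta=C\,\mathfrak s^+_\theta/|\mathfrak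 s^+_\theta|^2$, and $C_1,C_2$ are the (real) roots of the polynomial $$p_C(x)=\kappa_1\kappa^-x^2+(\Delta^2+2\kappa_1\varepsilon C)x+\kappa_1\kappa^+C^2 .$$ ($\psi'$ is determined only up to sign, since $\psi\mapsto-\psi$ amounts to a rigid motion.)
   Context: $\mathbb{R}^{4,2}$ is the real 6-dimensional vector space with inner product of signature $(++++--)$, $L^{4,1}$ its set of lightlike vectors, and the Lie quadric $\mathcal L=\{\langle\mathfrak v\rangle:\mathfrak v\ne0\text{ lightlike}\}$. A sphere congruence is a map $s:\Sigma^2\to\mathcal L$; a lift $\mathfrak s\in\Gamma s$ is a map into $L^{4,1}$ with $\langle\mathfrak s\rangle=s$. A Legendre immersion $\Lambda$ assigns to each point of $\Sigma^2$ a totally isotropic 2-plane $\Lambda=\langle\mathfrak s_1,\mathfrak s_2\rangle$ with $(d\mathfrak s_1,\mathfrak s_2)=0$, such that $d_p\mathfrak s(X)\in\Lambda(p)$ for all $\mathfrak s\in\Gamma\Lambda$ implies $X=0$. It envelopes $s$ if $s(p)\subset\Lambda(p)$ for all $p$. Its curvature sphere congruences $s_1,s_2$ are enveloped sphere congruences such that in suitable coordinates $(u,v)$ (curvature line coordinates) $(\mathfrak s_1)_u,(\mathfrak s_2)_v\in\Gamma\Lambda$ for any lifts. A sphere congruence is isothermic if it has a lift $\mathfrak s$ with $\mathfrak s_{uv}\parallel\mathfrak s$ for suitable coordinates. $\Lambda$ is an $\Omega$-surface if it envelopes a (possibly complex conjugate) pair of isothermic sphere congruences $s^\pm$ separating the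 curvature sphere congruences harmonically. It then has Christoffel dual lifts $\mathfrak s^\pm\in\Gamma s^\pm$, unique up to constant rescalings, i.e. in curvature line coordinates $\mathfrak s^-_u=CU\,\mathfrak s^+_u/|\mathfrak s^+_u|^2$, $\mathfrak s^-_v=-CV\,\mathfrak s^+_v/|\mathfrak s^+_v|^2$ with $U=U(u),V=V(v)$ and $C$ constant (for rotational surfaces, with $u=\theta$, $U$ is constant and taken to be $1$). A linear Weingarten surface $(\Lambda,\mathfrak p^\pm)$ is an $\Omega$-surface with fixed vectors $\mathfrak p^\pm$ such that $(\mathfrak s^\pm,\mathfrak p^\pm)=0$; the plane $\Pi=\langle\mathfrak p^+,\mathfrak p^-\rangle$ is spanned by a unit timelike vector $\mathfrak p$ (point sphere complex) and a perpendicular vector $\mathfrak q$ (space form vector), defining the space form $\{\mathfrak v\in L^{4,1}:(\mathfrak v,\mathfrak p)=0,(\mathfrak v,\mathfrak q)=-1\}$ of curvature $\kappa=-(\mathfrak q,\mathfrak q)$, here $\kappa\ne0$. A 1-parameter subgroup of rotations is a 1-parameter group of orthogonal transformations fixing $\mathfrak p,\mathfrak q$ and acting as the identity on the orthogonal complement of a 2-plane $\Pi_1\perp\Pi$; it is parabolic if $\Pi_1$ has signature $(+0)$. $\Lambda$ is rotational if it is spanned by sphere congruences of the form $(\theta,t)\mapsto\rho_\theta c(t)$; then $s^\pm$ are rotational too. Adapted basis: $\Pi_1$ is the rotation plane of $\rho^1$ and $\Pi_2=(\Pi\oplus\Pi_1)^\perp$, so $\mathbb{R}^{4,2}=\Pi\oplus_\perp\Pi_1\oplus_\perp\Pi_2$.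 $\{\mathfrak v_i,\mathfrak e_i\}$ is an orthonormal basis of $\Pi_i$ with $(\mathfrak e_i,\mathfrak e_i)=1$, $(\mathfrak v_i,\mathfrak v_i)=\kappa_i\in\{\pm1\}$. $\rho^i$ is the rotation group in $\Pi_i$: $\rho^i_\psi\mathfrak v_i=\cos\psi\,\mathfrak v_i+\sin\psi\,\mathfrak e_i$ if $\kappa_i=1$, and $\rho^i_\psi\mathfrak v_i=\cosh\psi\,\mathfrak v_i+\sinh\psi\,\mathfrak e_i$ if $\kappa_i=-1$. Further $\kappa^\pm=(\mathfrak p^\pm,\mathfrak p^\pm)$, $\varepsilon=(\mathfrak p^+,\mathfrak p^-)$, $\Delta=\kappa^+\kappa^--\varepsilon^2\ (\neq0)$. The Christoffel dual lifts are fixed by $(\mathfrak s^\pm,\mathfrak p^\pm)=0$, $(\mathfrak s^\pm,\mathfrak p^\mp)=\Delta$; the profile curve of $\mathfrak s^\pm$ is chosen with vanishing $\mathfrak e_1$-component. $r,\psi,d$ are functions of $t$ and $'$ is $d/dt$.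
   Formalization: The roots C_1, C_2 need not be real when κ^+ and κ^- are both positive (e.g. κ^±=1, ε=2, κ_1=1, κ_2=-1, C=-3); they are taken as complex roots, proved real in all other cases; the ψ' formula is stated where its denominator is nonzero. *)

theory Defs
  imports
    "HOL-Analysis.Analysis"
    "HOL-Computational_Algebra.Polynomial"
begin

section \<open>Smooth maps\<close>

text \<open>\<open>Ck_on k S f\<close> is meant for open \<open>S\<close>.\<close>

primrec Ck_on :: "nat \<Rightarrow> 'a::euclidean_space set \<Rightarrow> ('a \<Rightarrow> 'b::real_normed_vector) \<Rightarrow> bool" where
  "Ck_on 0 S f \<longleftrightarrow> continuous_on S f"
| "Ck_on (Suc k) S f \<longleftrightarrow>
     f differentiable_on S \<and> (\<forall>b\<in>Basis. Ck_on k S (\<lambda>x. frechet_derivative f (at x) b))"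

definition smooth_on :: "'a::euclidean_space set \<Rightarrow> ('a \<Rightarrow> 'b::real_normed_vector) \<Rightarrow> bool" where
  "smooth_on S f \<longleftrightarrow> (\<forall>k. Ck_on k S f)"

definition partial_u :: "(real \<times> real \<Rightarrow> 'b::real_normed_vector) \<Rightarrow> real \<times> real \<Rightarrow> 'b" where
  "partial_u f w = vector_derivative (\<lambda>u. f (u, snd w)) (at (fst w))"

definition partial_v :: "(real \<times> real \<Rightarrow> 'b::real_normed_vector) \<Rightarrow> real \<times> real \<Rightarrow> 'b" where
  "partial_v f w = vector_derivative (\<lambda>v. f (fst w, v)) (at (snd w))"

definition coordinates :: "(real \<times> real) set \<Rightarrow> (real \<times> real) set \<Rightarrow> (real \<times> real \<Rightarrow> real \<times> real) \<Rightarrow> bool"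
  where \<comment> \<open>\<open>x\<close> is the inverse of a chart: it sends the coordinates \<open>(u, v) \<in> W\<close> to a point of the surface\<close>
  "coordinates S W x \<longleftrightarrow> open W \<and> x ` W \<subseteq> S \<and> inj_on x W \<and> smooth_on W x \<and>
     (\<forall>w\<in>W. bij (frechet_derivative x (at w)))"

definition open_interval :: "real set \<Rightarrow> bool" where
  "open_interval J \<longleftrightarrow> J \<noteq> {} \<and> open J \<and> is_interval J"

definition reparametrization :: "real set \<Rightarrow> real set \<Rightarrow> (real \<Rightarrow> real) \<Rightarrow> bool" where
  "reparametrization J' J \<phi> \<longleftrightarrow> open_interval J' \<and> bij_betw \<phi> J' J \<and> smooth_on J' \<phi> \<and>
     (\<forall>\<tau>\<in>J'. deriv \<phi> \<tau> \<noteq> 0)"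

section \<open>Lie sphere geometry\<close>

type_synonym R42 = "(real ^ 4) \<times> (real ^ 2)"

definition lip :: "R42 \<Rightarrow> R42 \<Rightarrow> real" where
  "lip x y = fst x \<bullet> fst y - snd x \<bullet> snd y"

definition lie_quadric :: "R42 set set" where
  "lie_quadric = {span {v} | v. v \<noteq> 0 \<and> lip v v = 0}"

text \<open>Surfaces are open subsets \<open>S\<close> of the coordinate plane. Points of the Lie quadric and contact
  elements are represented by linear subspaces of \<open>R42\<close>.\<close>

definition lift :: "(real \<times> real) set \<Rightarrow> (real \<times> real \<Rightarrow> R42 set) \<Rightarrow> (real \<times> real \<Rightarrow> R42) \<Rightarrow> bool" where
  "lift S s f \<longleftrightarrow> smooth_on S f \<and> (\<forall>x\<in>S. span {f x} = s x)"

definition sphere_congruence :: "(real \<times> real) set \<Rightarrow> (real \<times> real \<Rightarrow> R42 set) \<Rightarrow> bool" where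
  "sphere_congruence S s \<longleftrightarrow> (\<forall>x\<in>S. s x \<in> lie_quadric) \<and>
     (\<forall>x\<in>S. \<exists>U f. open U \<and> x \<in> U \<and> U \<subseteq> S \<and> lift U s f)"

definition isotropic :: "R42 set \<Rightarrow> bool" where
  "isotropic L \<longleftrightarrow> (\<forall>x\<in>L. \<forall>y\<in>L. lip x y = 0)"

definition smooth_section :: "(real \<times> real) set \<Rightarrow> (real \<times> real \<Rightarrow> R42 set) \<Rightarrow> (real \<times> real \<Rightarrow> R42) \<Rightarrow> bool"
  where
  "smooth_section U \<Lambda> f \<longleftrightarrow> smooth_on U f \<and> (\<forall>x\<in>U. f x \<in> \<Lambda> x)"

definition legendre_immersion :: "(real \<times> real) set \<Rightarrow> (real \<times> real \<Rightarrow> R42 set) \<Rightarrow> bool" where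
  "legendre_immersion S \<Lambda> \<longleftrightarrow> open S \<and>
     (\<forall>x\<in>S. subspace (\<Lambda> x) \<and> dim (\<Lambda> x) = 2 \<and> isotropic (\<Lambda> x)) \<and>
     (\<forall>x\<in>S. \<exists>U f\<^sub>1 f\<^sub>2. open U \<and> x \<in> U \<and> U \<subseteq> S \<and> smooth_on U f\<^sub>1 \<and> smooth_on U f\<^sub>2 \<and>
        (\<forall>y\<in>U. \<Lambda> y = span {f\<^sub>1 y, f\<^sub>2 y} \<and>
               (\<forall>X. lip (frechet_derivative f\<^sub>1 (at y) X) (f\<^sub>2 y) = 0))) \<and>
     (\<forall>x\<in>S. \<forall>X.
        (\<forall>U f. open U \<and> x \<in> U \<and> U \<subseteq> S \<and> smooth_section U \<Lambda> f \<longrightarrow>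
               frechet_derivative f (at x) X \<in> \<Lambda> x)
        \<longrightarrow> X = 0)"

definition envelopes :: "(real \<times> real) set \<Rightarrow> (real \<times> real \<Rightarrow> R42 set) \<Rightarrow> (real \<times> real \<Rightarrow> R42 set) \<Rightarrow> bool"
  where
  "envelopes S \<Lambda> s \<longleftrightarrow> (\<forall>x\<in>S. s x \<subseteq> \<Lambda> x)"

definition curvature_line_coordinates ::
  "(real \<times> real \<Rightarrow> R42 set) \<Rightarrow> (real \<times> real \<Rightarrow> R42 set) \<Rightarrow> (real \<times> real \<Rightarrow> R42 set)
    \<Rightarrow> (real \<times> real) set \<Rightarrow> (real \<times> real \<Rightarrow> real \<times> real) \<Rightarrow> bool" where
  "curvature_line_coordinates \<Lambda> s\<^sub>1 s\<^sub>2 W x \<longleftrightarrow>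
     (\<forall>U f. open U \<and> U \<subseteq> W \<longrightarrow>
        (lift U (s\<^sub>1 \<circ> x) f \<longrightarrow> (\<forall>w\<in>U. partial_u f w \<in> \<Lambda> (x w))) \<and>
        (lift U (s\<^sub>2 \<circ> x) f \<longrightarrow> (\<forall>w\<in>U. partial_v f w \<in> \<Lambda> (x w))))"

definition curvature_spheres ::
  "(real \<times> real) set \<Rightarrow> (real \<times> real \<Rightarrow> R42 set) \<Rightarrow> (real \<times> real \<Rightarrow> R42 set)
    \<Rightarrow> (real \<times> real \<Rightarrow> R42 set) \<Rightarrow> bool" where
  "curvature_spheres S \<Lambda> s\<^sub>1 s\<^sub>2 \<longleftrightarrow>
     sphere_congruence S s\<^sub>1 \<and> sphere_congruence S s\<^sub>2 \<and> envelopes S \<Lambda> s\<^sub>1 \<and> envelopes S \<Lambda> s\<^sub>2 \<and>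
     (\<forall>y\<in>S. \<exists>W x. coordinates S W x \<and> y \<in> x ` W \<and> curvature_line_coordinates \<Lambda> s\<^sub>1 s\<^sub>2 W x)"

definition isothermic :: "(real \<times> real) set \<Rightarrow> (real \<times> real \<Rightarrow> R42 set) \<Rightarrow> bool" where
  "isothermic S s \<longleftrightarrow> sphere_congruence S s \<and>
     (\<forall>y\<in>S. \<exists>W x f. coordinates S W x \<and> y \<in> x ` W \<and> lift W (s \<circ> x) f \<and>
        (\<forall>w\<in>W. partial_v (partial_u f) w \<in> span {f w}))"

text \<open>Four points of a projective line with cross ratio \<open>-1\<close>; the scalars of the
  representatives are absorbed into \<open>a\<close> and \<open>b\<close>.\<close>

definition harmonic :: "R42 set \<Rightarrow> R42 set \<Rightarrow> R42 set \<Rightarrow> R42 set \<Rightarrow> bool" where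
  "harmonic A B P Q \<longleftrightarrow> (\<exists>a b. a \<noteq> b \<and> independent {a, b} \<and> A = span {a} \<and> B = span {b} \<and>
     P = span {a + b} \<and> Q = span {a - b})"

text \<open>Only real pairs \<open>s\<^sup>+, s\<^sup>-\<close> are considered, which is the case of real sphere complexes.\<close>

definition omega_surface ::
  "(real \<times> real) set \<Rightarrow> (real \<times> real \<Rightarrow> R42 set) \<Rightarrow> (real \<times> real \<Rightarrow> R42 set)
    \<Rightarrow> (real \<times> real \<Rightarrow> R42 set) \<Rightarrow> bool" where
  "omega_surface S \<Lambda> sp sm \<longleftrightarrow> legendre_immersion S \<Lambda> \<and>
     isothermic S sp \<and> isothermic S sm \<and> envelopes S \<Lambda> sp \<and> envelopes S \<Lambda> sm \<and>
     (\<exists>s\<^sub>1 s\<^sub>2. curvature_spheres S \<Lambda> s\<^sub>1 s\<^sub>2 \<and> (\<forall>x\<in>S. harmonic (s\<^sub>1 x) (s\<^sub>2 x) (sp x) (sm x)))"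

text \<open>Christoffel duality of the lifts \<open>fp, fm\<close>, where the coordinates of \<open>S\<close> themselves are
  curvature line coordinates.\<close>

definition christoffel_dual ::
  "(real \<times> real) set \<Rightarrow> (real \<times> real \<Rightarrow> R42 set) \<Rightarrow> real \<Rightarrow> (real \<Rightarrow> real) \<Rightarrow> (real \<Rightarrow> real)
    \<Rightarrow> (real \<times> real \<Rightarrow> R42) \<Rightarrow> (real \<times> real \<Rightarrow> R42) \<Rightarrow> bool" where
  "christoffel_dual S \<Lambda> C U V fp fm \<longleftrightarrow>
     (\<exists>s\<^sub>1 s\<^sub>2. curvature_spheres S \<Lambda> s\<^sub>1 s\<^sub>2 \<and> curvature_line_coordinates \<Lambda> s\<^sub>1 s\<^sub>2 S (\<lambda>w. w)) \<and>
     (\<forall>w\<in>S. lip (partial_u fp w) (partial_u fp w) \<noteq> 0 \<and> lip (partial_v fp w) (partial_v fp w) \<noteq> 0 \<and>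
        partial_u fm w
          = (C * U (fst w) / lip (partial_u fp w) (partial_u fp w)) *\<^sub>R partial_u fp w \<and>
        partial_v fm w
          = - (C * V (snd w) / lip (partial_v fp w) (partial_v fp w)) *\<^sub>R partial_v fp w)"

text \<open>\<open>p\<close> is the point sphere complex and \<open>q\<close> the space form vector, so the ambient space form has
  curvature \<open>- lip q q\<close>.\<close>

definition linear_weingarten ::
  "(real \<times> real) set \<Rightarrow> (real \<times> real \<Rightarrow> R42 set) \<Rightarrow> (real \<times> real \<Rightarrow> R42 set)
    \<Rightarrow> (real \<times> real \<Rightarrow> R42 set) \<Rightarrow> R42 \<Rightarrow> R42 \<Rightarrow> R42 \<Rightarrow> R42 \<Rightarrow> bool" where
  "linear_weingarten S \<Lambda> sp sm pp pm p q \<longleftrightarrow> omega_surface S \<Lambda> sp sm \<and>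
     (\<forall>x\<in>S. (\<forall>v\<in>sp x. lip v pp = 0) \<and> (\<forall>v\<in>sm x. lip v pm = 0)) \<and>
     lip p p = -1 \<and> lip p q = 0 \<and> q \<noteq> 0 \<and> span {pp, pm} = span {p, q}"

section \<open>Rotations\<close>

definition cs :: "real \<Rightarrow> real \<Rightarrow> real" where
  "cs \<kappa> \<theta> = (if \<kappa> = 1 then cos \<theta> else cosh \<theta>)"

definition sn :: "real \<Rightarrow> real \<Rightarrow> real" where
  "sn \<kappa> \<theta> = (if \<kappa> = 1 then sin \<theta> else sinh \<theta>)"

text \<open>For \<open>lip e e = 1\<close>, \<open>lip v v = \<kappa> \<in> {1, -1}\<close> and \<open>lip v e = 0\<close>: the rotation in the plane of
  \<open>v, e\<close>, where \<open>\<kappa> * lip x v\<close> and \<open>lip x e\<close> are the coordinates of \<open>x\<close> along \<open>v\<close> and \<open>e\<close>.\<close>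

definition rotation :: "real \<Rightarrow> R42 \<Rightarrow> R42 \<Rightarrow> real \<Rightarrow> R42 \<Rightarrow> R42" where
  "rotation \<kappa> v e \<theta> x =
     x + (\<kappa> * lip x v) *\<^sub>R (cs \<kappa> \<theta> *\<^sub>R v + sn \<kappa> \<theta> *\<^sub>R e - v)
       + lip x e *\<^sub>R (- (\<kappa> * sn \<kappa> \<theta>) *\<^sub>R v + cs \<kappa> \<theta> *\<^sub>R e - e)"

lemma lip_simps:
  "lip (x + y) z = lip x z + lip y z" "lip z (x + y) = lip z x + lip z y"
  "lip (x - y) z = lip x z - lip y z" "lip z (x - y) = lip z x - lip z y"
  "lip (a *\<^sub>R x) z = a * lip x z" "lip z (a *\<^sub>R x) = a * lip z x"
  by (simp_all add: lip_def inner_simps algebra_simps)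

lemma lip_commute: "lip x y = lip y x"
  by (simp add: lip_def inner_commute)

lemma cs_sn:
  assumes "\<kappa> = 1 \<or> \<kappa> = -1"
  shows "cs \<kappa> 0 = 1" "sn \<kappa> 0 = 0" "cs \<kappa> \<theta> * cs \<kappa> \<theta> = 1 - \<kappa> * (sn \<kappa> \<theta> * sn \<kappa> \<theta>)"
    and "cs \<kappa> (\<theta> + \<eta>) = cs \<kappa> \<theta> * cs \<kappa> \<eta> - \<kappa> * (sn \<kappa> \<theta> * sn \<kappa> \<eta>)"
    and "sn \<kappa> (\<theta> + \<eta>) = sn \<kappa> \<theta> * cs \<kappa> \<eta> + cs \<kappa> \<theta> * sn \<kappa> \<eta>"
  using assms sin_cos_squared_add[of \<theta>] cosh_square_eq[of \<theta>]
  by (auto simp: cs_def sn_def cos_add sin_add cosh_add sinh_add power2_eq_square)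

lemma rotation_one_parameter_group:
  assumes "\<kappa> = 1 \<or> \<kappa> = -1" "lip v v = \<kappa>" "lip e e = 1" "lip v e = 0"
  shows rotation_v: "rotation \<kappa> v e \<theta> v = cs \<kappa> \<theta> *\<^sub>R v + sn \<kappa> \<theta> *\<^sub>R e"
    and rotation_0: "rotation \<kappa> v e 0 x = x"
    and rotation_add: "rotation \<kappa> v e (\<theta> + \<eta>) x = rotation \<kappa> v e \<theta> (rotation \<kappa> v e \<eta> x)"
    and rotation_orthogonal: "lip (rotation \<kappa> v e \<theta> x) (rotation \<kappa> v e \<theta> y) = lip x y"
    and rotation_fixes: "lip x v = 0 \<Longrightarrow> lip x e = 0 \<Longrightarrow> rotation \<kappa> v e \<theta> x = x"
proof -
  have ev: "lip e v = 0" using assms(4) lip_commute[of e v] by simp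
  have kk: "\<kappa> * \<kappa> = 1" using assms(1) by auto
  note l = lip_simps assms(2-4) ev
  show "rotation \<kappa> v e \<theta> v = cs \<kappa> \<theta> *\<^sub>R v + sn \<kappa> \<theta> *\<^sub>R e"
    by (simp add: rotation_def l kk)
  show "rotation \<kappa> v e 0 x = x"
    by (simp add: rotation_def cs_sn[OF assms(1)])
  show "rotation \<kappa> v e \<theta> x = x" if "lip x v = 0" "lip x e = 0"
    using that by (simp add: rotation_def)
  have v: "\<kappa> * lip (rotation \<kappa> v e \<eta> x) v = cs \<kappa> \<eta> * (\<kappa> * lip x v) - \<kappa> * sn \<kappa> \<eta> * lip x e" for \<eta> x
    using assms(1) by (auto simp: rotation_def l algebra_simps)
  have e: "lip (rotation \<kappa> v e \<eta> x) e = sn \<kappa> \<eta> * (\<kappa> * lip x v) + cs \<kappa> \<eta> * lip x e" for \<eta> x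
    using assms(1) by (auto simp: rotation_def l algebra_simps)
  show "rotation \<kappa> v e (\<theta> + \<eta>) x = rotation \<kappa> v e \<theta> (rotation \<kappa> v e \<eta> x)"
    unfolding rotation_def[of \<kappa> v e \<theta> "rotation \<kappa> v e \<eta> x"] v e
    unfolding rotation_def cs_sn(4,5)[OF assms(1)]
    using assms(1) by (auto simp: algebra_simps)
  have c: "lip v y = lip y v" "lip e y = lip y e" "lip v x = lip x v" "lip e x = lip x e"
    by (simp_all only: lip_commute)
  have sq: "cs \<kappa> \<theta> * cs \<kappa> \<theta> = 1 - \<kappa> * (sn \<kappa> \<theta> * sn \<kappa> \<theta>)"
    by (rule cs_sn(3)[OF assms(1)])
  show "lip (rotation \<kappa> v e \<theta> x) (rotation \<kappa> v e \<theta> y) = lip x y"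
    unfolding rotation_def l c using sq kk by algebra
qed

definition rotational ::
  "real set \<Rightarrow> real set \<Rightarrow> (real \<Rightarrow> R42 \<Rightarrow> R42) \<Rightarrow> (real \<times> real \<Rightarrow> R42 set) \<Rightarrow> bool" where
  "rotational I J \<rho> \<Lambda> \<longleftrightarrow> (\<exists>c\<^sub>1 c\<^sub>2. smooth_on J c\<^sub>1 \<and> smooth_on J c\<^sub>2 \<and>
     (\<forall>\<theta>\<in>I. \<forall>t\<in>J. span {\<rho> \<theta> (c\<^sub>1 t)} \<in> lie_quadric \<and> span {\<rho> \<theta> (c\<^sub>2 t)} \<in> lie_quadric \<and>
        \<Lambda> (\<theta>, t) = span {\<rho> \<theta> (c\<^sub>1 t), \<rho> \<theta> (c\<^sub>2 t)}))"

text \<open>Together with the nondegeneracy of \<open>span {pp, pm}\<close> these relations make the six vectors a basis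
  of \<open>R42\<close>. The plane \<open>span {v\<^sub>1, e\<^sub>1}\<close> is nondegenerate, i.e. its rotations are not parabolic.\<close>

definition adapted_basis ::
  "R42 \<Rightarrow> R42 \<Rightarrow> R42 \<Rightarrow> R42 \<Rightarrow> R42 \<Rightarrow> R42 \<Rightarrow> real \<Rightarrow> real \<Rightarrow> bool" where
  "adapted_basis pp pm v\<^sub>1 e\<^sub>1 v\<^sub>2 e\<^sub>2 \<kappa>\<^sub>1 \<kappa>\<^sub>2 \<longleftrightarrow>
     \<kappa>\<^sub>1 \<in> {1, -1} \<and> lip v\<^sub>1 v\<^sub>1 = \<kappa>\<^sub>1 \<and> lip e\<^sub>1 e\<^sub>1 = 1 \<and> lip v\<^sub>1 e\<^sub>1 = 0 \<and>
     \<kappa>\<^sub>2 \<in> {1, -1} \<and> lip v\<^sub>2 v\<^sub>2 = \<kappa>\<^sub>2 \<and> lip e\<^sub>2 e\<^sub>2 = 1 \<and> lip v\<^sub>2 e\<^sub>2 = 0 \<and>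
     (\<forall>x\<in>{pp, pm}. \<forall>y\<in>{v\<^sub>1, e\<^sub>1, v\<^sub>2, e\<^sub>2}. lip x y = 0) \<and>
     (\<forall>x\<in>{v\<^sub>1, e\<^sub>1}. \<forall>y\<in>{v\<^sub>2, e\<^sub>2}. lip x y = 0)"

definition profile_poly :: "real \<Rightarrow> real \<Rightarrow> real \<Rightarrow> real \<Rightarrow> real \<Rightarrow> real \<Rightarrow> real poly" where
  "profile_poly \<kappa>p \<kappa>m \<epsilon> \<Delta> \<kappa>\<^sub>1 C = [: \<kappa>\<^sub>1 * \<kappa>p * C\<^sup>2, \<Delta>\<^sup>2 + 2 * \<kappa>\<^sub>1 * \<epsilon> * C, \<kappa>\<^sub>1 * \<kappa>m :]"

end

(* The tangent of the profile curve of s+ is orthogonal to s+ and, because of the contact condition of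
   the Legendre map, also to s-. Duality along theta forces the part of s- in the plane of rho^1 to be
   C/r times the rotated v1, and the part in the plane of rho^2 is constrained by (s-,s-) = (s+,s-) = 0.
   In the three-dimensional space spanned by the rotated v1, v2, e2 the tangent is therefore a
   nonvanishing multiple mu of the cross product N of the parts of s+ and s-, whose square length is the
   constant kappa_1 kappa_2 Delta^3; it is positive since the signature is (4,2). Hence the functions of
   the statement are the components of N up to a factor, p_C(r^2) arises from (s-,s-) = 0, and the
   parameter change dt/dtau = const * r / |mu| normalizes the tangent. No zeros of r', d or p_C(r^2)
   have to be excluded on the way. *)
theory Submission
  imports Defs
begin

text \<open>The constant square length of N is a Gram determinant. As s+ and s- are lightlike and
  mutually orthogonal, the Gram matrix of their parts outside the plane of \<open>pp, pm\<close> is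
  minus that of their parts inside it. The normalization fixes the latter as
  \<open>- \<epsilon> pp + \<kappa>p pm\<close> and \<open>\<kappa>m pp - \<epsilon> pm\<close>,
  whose Gram determinant is \<open>\<Delta> ^ 3\<close>; the cross product contributes the
  determinant \<open>\<kappa>\<^sub>1 * \<kappa>\<^sub>2\<close> of the metric on the
  three-dimensional space. The parameter change has to be smooth although mu contains components of
  s-. Its square, however, is the square length of the profile tangent of s+ divided by that
  constant, an expression in \<open>r\<close>, \<open>d\<close> and \<open>\<psi>\<close> alone. So
  |mu| is smooth, and continuity of mu settles its sign. The roots are kept complex because the
  discriminant of p_C, \<open>\<Delta>^4 + 4 \<kappa>\<^sub>1 \<epsilon> \<Delta>^2 C - 4 \<Delta>
  C^2\<close>, takes negative values for some \<open>C\<close> when \<open>\<kappa>p\<close> and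
  \<open>\<kappa>m\<close> are both positive; otherwise the sign of p_C at one point forces real
  roots.\<close>

section \<open>Smooth functions of one variable\<close>

text \<open>\<open>frechet_derivative\<close> at a point of the open set \<open>S\<close> sees only
  nearby values, so agreement on \<open>S\<close> passes to all iterated derivatives.\<close>

lemma Ck_on_cong:
  assumes "open S" "Ck_on k S f" "\<And>x. x \<in> S \<Longrightarrow> f x = g x"
  shows "Ck_on k S g"
  using assms(2,3)
proof (induction k arbitrary: f g)
  case 0
  then show ?case
    using continuous_on_cong[of S S f g] by simp
next
  case (Suc k)
  have der: "(g has_derivative frechet_derivative f (at x)) (at x)" if "x \<in> S" for x
  proof -
    have "f differentiable (at x)"
      using Suc.prems(1) assms(1) that differentiable_on_eq_differentiable_at by auto
    then have "(f has_derivative frechet_derivative f (at x)) (at x)"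
      using frechet_derivative_works by blast
    then show ?thesis
      by (rule has_derivative_transform_within_open[OF _ assms(1) that]) (use Suc.prems(2) in auto)
  qed
  have "g differentiable_on S"
    unfolding differentiable_on_eq_differentiable_at[OF assms(1)]
    using der differentiableI by blast
  moreover have "Ck_on k S (\<lambda>x. frechet_derivative g (at x) b)" if "b \<in> Basis" for b
  proof (rule Suc.IH)
    show "Ck_on k S (\<lambda>x. frechet_derivative f (at x) b)"
      using Suc.prems(1) that by simp
  qed (use der frechet_derivative_at in metis)
  ultimately show ?case by simp
qed

text \<open>On the line \<open>Basis\<close> is {1}, so one step of \<open>Ck_on\<close> is an
  ordinary derivative. This rule and the elimination rule after it let the closure properties be
  proved by real calculus.\<close>

lemma Ck_on_SucI:
  fixes f :: "real \<Rightarrow> real"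
  assumes "open S" and d: "\<And>x. x \<in> S \<Longrightarrow> (f has_real_derivative f' x) (at x)" and C: "Ck_on k S f'"
  shows "Ck_on (Suc k) S f"
proof -
  have "f differentiable (at x)" if "x \<in> S" for x
    using d[OF that] by (auto simp: real_differentiable_def)
  then have "f differentiable_on S"
    by (simp add: differentiable_on_eq_differentiable_at[OF assms(1)])
  moreover have "f' x = frechet_derivative f (at x) 1" if "x \<in> S" for x
    using frechet_derivative_at[OF d[OF that, unfolded has_field_derivative_def], symmetric] by simp
  ultimately show ?thesis
    using Ck_on_cong[OF assms(1) C] by simp
qed

lemma Ck_on_SucE:
  fixes f :: "real \<Rightarrow> real"
  assumes "open S" and C: "Ck_on (Suc k) S f"
  obtains f' where "\<And>x. x \<in> S \<Longrightarrow> (f has_real_derivative f' x) (at x)" "Ck_on k S f'"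
proof
  fix x assume "x \<in> S"
  then have "f differentiable (at x)"
    using C differentiable_on_eq_differentiable_at[OF assms(1), of f] by simp
  then have D: "(f has_derivative frechet_derivative f (at x)) (at x)"
    using frechet_derivative_works by blast
  have "frechet_derivative f (at x) h = frechet_derivative f (at x) 1 * h" for h
    using linear_scale[OF has_derivative_linear[OF D], of h 1] by simp
  then have "frechet_derivative f (at x) = (*) (frechet_derivative f (at x) 1)"
    by (rule ext)
  then show "(f has_real_derivative frechet_derivative f (at x) 1) (at x)"
    using D by (simp add: has_field_derivative_def)
next
  show "Ck_on k S (\<lambda>x. frechet_derivative f (at x) 1)"
    using C by simp
qed

text \<open>The product and chain rules mix derivatives with undifferentiated functions, which have
  to be lowered to the same class.\<close>

lemma Ck_on_Suc_imp:
  fixes f :: "real \<Rightarrow> real"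
  assumes "open S" "Ck_on (Suc k) S f"
  shows "Ck_on k S f"
  using assms(2)
proof (induction k arbitrary: f)
  case 0
  then show ?case by (simp add: differentiable_imp_continuous_on)
next
  case (Suc k)
  obtain f' where f': "\<And>x. x \<in> S \<Longrightarrow> (f has_real_derivative f' x) (at x)" "Ck_on (Suc k) S f'"
    using Ck_on_SucE[OF assms(1) Suc.prems] by blast
  show ?case by (rule Ck_on_SucI[OF assms(1) f'(1) Suc.IH[OF f'(2)]])
qed

lemma Ck_on_const: "Ck_on k S (\<lambda>_. c)"
proof (induction k arbitrary: c)
  case (Suc k)
  then show ?case by (simp add: frechet_derivative_const)
qed simp

lemma Ck_on_add:
  fixes f g :: "real \<Rightarrow> real"
  assumes "open S" "Ck_on k S f" "Ck_on k S g"
  shows "Ck_on k S (\<lambda>x. f x + g x)"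
  using assms(2,3)
proof (induction k arbitrary: f g)
  case 0
  then show ?case by (simp add: continuous_on_add continuous_on_mult)
next
  case (Suc k)
  obtain f' where f': "\<And>x. x \<in> S \<Longrightarrow> (f has_real_derivative f' x) (at x)" "Ck_on k S f'"
    using Ck_on_SucE[OF assms(1) Suc.prems(1)] by blast
  obtain g' where g': "\<And>x. x \<in> S \<Longrightarrow> (g has_real_derivative g' x) (at x)" "Ck_on k S g'"
    using Ck_on_SucE[OF assms(1) Suc.prems(2)] by blast
  show ?case
    by (rule Ck_on_SucI[OF assms(1) DERIV_add[OF f'(1) g'(1)] Suc.IH[OF f'(2) g'(2)]])
qed

lemma Ck_on_mult:
  fixes f g :: "real \<Rightarrow> real"
  assumes "open S" "Ck_on k S f" "Ck_on k S g"
  shows "Ck_on k S (\<lambda>x. f x * g x)"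
  using assms(2,3)
proof (induction k arbitrary: f g)
  case 0
  then show ?case by (simp add: continuous_on_add continuous_on_mult)
next
  case (Suc k)
  obtain f' where f': "\<And>x. x \<in> S \<Longrightarrow> (f has_real_derivative f' x) (at x)" "Ck_on k S f'"
    using Ck_on_SucE[OF assms(1) Suc.prems(1)] by blast
  obtain g' where g': "\<And>x. x \<in> S \<Longrightarrow> (g has_real_derivative g' x) (at x)" "Ck_on k S g'"
    using Ck_on_SucE[OF assms(1) Suc.prems(2)] by blast
  note fg = Ck_on_Suc_imp[OF assms(1) Suc.prems(1)] Ck_on_Suc_imp[OF assms(1) Suc.prems(2)]
  show ?case
    by (rule Ck_on_SucI[OF assms(1) DERIV_mult[OF f'(1) g'(1)]
          Ck_on_add[OF assms(1) Suc.IH[OF f'(2) fg(2)] Suc.IH[OF g'(2) fg(1)]]])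
qed

lemma Ck_on_compose:
  fixes f g :: "real \<Rightarrow> real"
  assumes "open S" "open T" "g ` S \<subseteq> T" "Ck_on k T f" "Ck_on k S g"
  shows "Ck_on k S (\<lambda>x. f (g x))"
  using assms(4,5)
proof (induction k arbitrary: f)
  case 0
  then show ?case
    using assms(3) by (auto intro: continuous_on_compose2)
next
  case (Suc k)
  obtain f' where f': "\<And>x. x \<in> T \<Longrightarrow> (f has_real_derivative f' x) (at x)" "Ck_on k T f'"
    using Ck_on_SucE[OF assms(2) Suc.prems(1)] by blast
  obtain g' where g': "\<And>x. x \<in> S \<Longrightarrow> (g has_real_derivative g' x) (at x)" "Ck_on k S g'"
    using Ck_on_SucE[OF assms(1) Suc.prems(2)] by blast
  have "((\<lambda>x. f (g x)) has_real_derivative f' (g x) * g' x) (at x)" if "x \<in> S" for x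
    using DERIV_chain2[OF f'(1) g'(1)] assms(3) that by blast
  then show ?case
    by (rule Ck_on_SucI[OF assms(1) _ Ck_on_mult[OF assms(1)
          Suc.IH[OF f'(2) Ck_on_Suc_imp[OF assms(1) Suc.prems(2)]] g'(2)]])
qed

lemma smooth_on_differentiable:
  assumes "open S" "smooth_on S f" "x \<in> S"
  shows "f differentiable at x"
proof -
  have "Ck_on (Suc 0) S f" using assms(2) unfolding smooth_on_def by blast
  then have "f differentiable_on S" by simp
  then show ?thesis
    using differentiable_on_eq_differentiable_at[OF assms(1)] assms(3) by blast
qed

lemma smooth_on_continuous: "smooth_on S f \<Longrightarrow> continuous_on S f"
  unfolding smooth_on_def by (metis Ck_on.simps(1))

lemma smooth_on_const: "smooth_on S (\<lambda>_. c)"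
  by (simp add: smooth_on_def Ck_on_const)

lemma smooth_on_add:
  fixes f g :: "real \<Rightarrow> real"
  shows "open S \<Longrightarrow> smooth_on S f \<Longrightarrow> smooth_on S g \<Longrightarrow> smooth_on S (\<lambda>x. f x + g x)"
  using Ck_on_add unfolding smooth_on_def by metis

lemma smooth_on_mult:
  fixes f g :: "real \<Rightarrow> real"
  shows "open S \<Longrightarrow> smooth_on S f \<Longrightarrow> smooth_on S g \<Longrightarrow> smooth_on S (\<lambda>x. f x * g x)"
  using Ck_on_mult unfolding smooth_on_def by metis

lemma smooth_on_DERIV:
  fixes f :: "real \<Rightarrow> real"
  assumes "open S" "smooth_on S f" "x \<in> S"
  shows "(f has_real_derivative deriv f x) (at x)"
proof -
  obtain f' where "(f has_real_derivative f' x) (at x)"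
    using Ck_on_SucE[OF assms(1)] assms(2,3) unfolding smooth_on_def by blast
  then show ?thesis using DERIV_imp_deriv by metis
qed

lemma smooth_on_deriv:
  fixes f :: "real \<Rightarrow> real"
  assumes "open S" "smooth_on S f"
  shows "smooth_on S (deriv f)"
  unfolding smooth_on_def
proof
  fix k
  obtain f' where f': "\<And>x. x \<in> S \<Longrightarrow> (f has_real_derivative f' x) (at x)" "Ck_on k S f'"
    using Ck_on_SucE[OF assms(1)] assms(2) unfolding smooth_on_def by blast
  show "Ck_on k S (deriv f)"
    by (rule Ck_on_cong[OF assms(1) f'(2)]) (simp add: DERIV_imp_deriv[OF f'(1)])
qed

text \<open>Differentiation lowers the exponent, so the induction keeps \<open>a\<close> arbitrary.
  The exponent -1/2 will express 1/|mu|.\<close>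

lemma smooth_on_powr: "smooth_on {0<..} (\<lambda>x. x powr a :: real)"
proof -
  have "Ck_on k {0<..} (\<lambda>x. x powr a :: real)" for k
  proof (induction k arbitrary: a)
    case 0
    then show ?case by (simp add: continuous_on_powr continuous_on_id continuous_on_const)
  next
    case (Suc k)
    then have "Ck_on k {0<..} (\<lambda>x. a * x powr (a - 1))"
      by (intro Ck_on_mult Ck_on_const) auto
    then show ?case
      by (intro Ck_on_SucI[of "{0<..}" _ "\<lambda>x. a * x powr (a - 1)"] has_real_derivative_powr) auto
  qed
  then show ?thesis by (simp add: smooth_on_def)
qed

lemma smooth_on_compose:
  fixes f g :: "real \<Rightarrow> real"
  assumes "open S" "open T" "g ` S \<subseteq> T" "smooth_on T f" "smooth_on S g"
  shows "smooth_on S (\<lambda>x. f (g x))"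
  unfolding smooth_on_def
  using Ck_on_compose[OF assms(1-3)] assms(4,5) by (simp add: smooth_on_def)

text \<open>Bootstrapping: if the solution is of class \<open>k\<close>, then so is its derivative
  \<open>g (\<phi> x)\<close>, and the solution is of class \<open>Suc k\<close>.\<close>

lemma smooth_on_autonomous_ode:
  fixes \<phi> g :: "real \<Rightarrow> real"
  assumes "open S" "open T" "\<phi> ` S \<subseteq> T" "smooth_on T g"
    and d: "\<And>x. x \<in> S \<Longrightarrow> (\<phi> has_real_derivative g (\<phi> x)) (at x)"
  shows "smooth_on S \<phi>"
proof -
  have "Ck_on k S \<phi>" for k
  proof (induction k)
    case 0
    have "continuous_on S \<phi>"
      by (rule DERIV_continuous_on[OF has_field_derivative_at_within[OF d]])
    then show ?case by simp
  next
    case (Suc k)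
    then have g\<phi>: "Ck_on k S (\<lambda>x. g (\<phi> x))"
      using assms(4) Ck_on_compose[OF assms(1-3)] unfolding smooth_on_def by simp
    show ?case
      by (rule Ck_on_SucI[OF assms(1) d g\<phi>])
  qed
  then show ?thesis by (simp add: smooth_on_def)
qed

section \<open>Antiderivatives and separable equations on an open interval\<close>

lemma antiderivative_open_interval:
  fixes f :: "real \<Rightarrow> real"
  assumes "open_interval J" "continuous_on J f"
  obtains F where "\<And>x. x \<in> J \<Longrightarrow> (F has_real_derivative f x) (at x)"
proof -
  obtain c where c: "c \<in> J" using assms(1) by (auto simp: open_interval_def)
  \<comment> \<open>An integral over an empty interval is 0, so this difference is the signed
    integral from \<open>c\<close> to \<open>x\<close>.\<close>
  define F where "F x = integral {c..x} f - integral {x..c} f" for x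
  have "(F has_real_derivative f x) (at x)" if x: "x \<in> J" for x
  proof -
    have J: "open J" "is_interval J" using assms(1) by (auto simp: open_interval_def)
    have "min c x \<in> J" "max c x \<in> J" using c x by (auto simp: min_def max_def)
    then obtain e e' where "e > 0" "cball (min c x) e \<subseteq> J" and "e' > 0" "cball (max c x) e' \<subseteq> J"
      using J(1) open_contains_cball by metis
    then have e: "e > 0" "min c x - e \<in> J" "e' > 0" "max c x + e' \<in> J"
      by (auto simp: subset_iff cball_def dist_real_def)
    \<comment> \<open>A compact interval inside \<open>J\<close> with \<open>c\<close> and
      \<open>x\<close> in its interior: there the fundamental theorem gives a two-sided
      derivative.\<close>
    define a b where "a = min c x - e" and "b = max c x + e'"
    have ab: "a \<in> J" "b \<in> J" "a < c" "a < x" "c < b" "x < b"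
      using e by (auto simp: a_def b_def)
    then have sub: "{a..b} \<subseteq> J"
      using J(2) by (meson atLeastAtMost_iff is_interval_1 subsetI)
    then have cont: "continuous_on {a..b} f" using assms(2) continuous_on_subset by blast
    then have int: "f integrable_on {u..v}" if "a \<le> u" "v \<le> b" for u v
      using that by (meson atLeastatMost_subset_iff integrable_continuous_interval continuous_on_subset)
    have "((\<lambda>y. integral {a..y} f) has_real_derivative f x) (at x within {a..b})"
      using integral_has_real_derivative[OF cont] ab by auto
    then have "((\<lambda>y. integral {a..y} f) has_real_derivative f x) (at x)"
      using ab at_within_Icc_at by metis
    then have D: "((\<lambda>y. integral {a..y} f - integral {a..c} f) has_real_derivative f x) (at x)"
      by (auto intro!: derivative_eq_intros)
    have "F y = integral {a..y} f - integral {a..c} f" if "y \<in> {a<..<b}" for y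
    proof (cases "c \<le> y")
      case True
      then have "integral {a..c} f + integral {c..y} f = integral {a..y} f"
        using that ab by (intro Henstock_Kurzweil_Integration.integral_combine int) auto
      moreover have "integral {y..c} f = 0"
        using True by (cases "c = y") auto
      ultimately show ?thesis by (simp add: F_def)
    next
      case False
      then have "integral {a..y} f + integral {y..c} f = integral {a..c} f"
        using that ab by (intro Henstock_Kurzweil_Integration.integral_combine int) auto
      then show ?thesis using False by (simp add: F_def)
    qed
    then show ?thesis
      using ab by (intro has_field_derivative_transform_within_open[OF D open_greaterThanLessThan, of a b]) auto
  qed
  then show ?thesis using that by blast
qed

text \<open>The separable equation \<open>\<phi>' = g \<circ> \<phi>\<close> is solved by inverting an antiderivative of \<open>1 / g\<close>.\<close>

lemma reparametrization_exists:
  fixes g :: "real \<Rightarrow> real"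
  assumes J: "open_interval J" and g: "smooth_on J g" and nz: "\<And>t. t \<in> J \<Longrightarrow> g t \<noteq> 0"
  obtains J' \<phi> where "reparametrization J' J \<phi>"
    and "\<And>\<tau>. \<tau> \<in> J' \<Longrightarrow> (\<phi> has_real_derivative g (\<phi> \<tau>)) (at \<tau>)"
proof -
  have J': "open J" "is_interval J" "J \<noteq> {}" using J by (auto simp: open_interval_def)
  have "continuous_on J g" using g by (rule smooth_on_continuous)
  then have "continuous_on J (\<lambda>t. 1 / g t)" using nz by (intro continuous_intros) auto
  then obtain G where G: "\<And>t. t \<in> J \<Longrightarrow> (G has_real_derivative 1 / g t) (at t)"
    using antiderivative_open_interval[OF J] by blast
  have inj: "inj_on G J"
  proof (rule linorder_inj_onI')
    fix x y assume xy: "x \<in> J" "y \<in> J" "x < y"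
    then have in_J: "z \<in> J" if "x \<le> z" "z \<le> y" for z
      using J'(2) that by (meson is_interval_1)
    obtain z where "x < z" "z < y" "G y - G x = (y - x) * (1 / g z)"
      using MVT2[OF xy(3), of G "\<lambda>z. 1 / g z"] G in_J by blast
    then show "G x \<noteq> G y" using nz[of z] in_J xy by auto
  qed
  have cont: "continuous_on J G"
    by (rule DERIV_continuous_on[OF has_field_derivative_at_within[OF G]])
  define \<phi> where "\<phi> = the_inv_into J G"
  have \<phi>G: "\<phi> (G t) = t" if "t \<in> J" for t
    using the_inv_into_f_f[OF inj that] by (simp add: \<phi>_def)
  have D: "(\<phi> has_real_derivative g (\<phi> \<tau>)) (at \<tau>)" if \<tau>: "\<tau> \<in> G ` J" for \<tau>
  proof -
    obtain t where t: "t \<in> J" "\<tau> = G t" using \<tau> by blast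
    \<comment> \<open>Inverse function theorem: the slope of the inverse at \<open>G t\<close> is
      the reciprocal of \<open>1 / g t\<close>.\<close>
    have "(\<phi> has_derivative (*) (g t)) (at (G t))"
      by (rule has_derivative_inverse_strong[OF J'(1) t(1) cont \<phi>G
            G[OF t(1), unfolded has_field_derivative_def]]) (use nz[OF t(1)] in auto)
    then show ?thesis using t \<phi>G by (simp add: has_field_derivative_def)
  qed
  have op: "open (G ` J)"
    using invariance_of_domain[OF cont J'(1) inj] .
  have "is_interval (G ` J)"
    using connected_continuous_image[OF cont] J'(2) is_interval_connected_1 by blast
  then have "open_interval (G ` J)"
    using op J'(3) by (simp add: open_interval_def)
  moreover have "bij_betw \<phi> (G ` J) J"
    using inj bij_betw_the_inv_into unfolding \<phi>_def by (metis inj_on_imp_bij_betw)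
  moreover have "smooth_on (G ` J) \<phi>"
    by (rule smooth_on_autonomous_ode[OF op J'(1) _ g D]) (use \<phi>G in auto)
  moreover have "deriv \<phi> \<tau> \<noteq> 0" if "\<tau> \<in> G ` J" for \<tau>
    using DERIV_imp_deriv[OF D[OF that]] nz \<phi>G that by auto
  ultimately have "reparametrization (G ` J) J \<phi>"
    by (simp add: reparametrization_def)
  then show ?thesis using that D by blast
qed

section \<open>The signature of the inner product\<close>

text \<open>Makes the general rules on sums, continuity and derivatives of bilinear maps available
  for \<open>lip\<close>. The bound 2 comes from estimating the two blocks separately.\<close>

lemma bounded_bilinear_lip: "bounded_bilinear lip"
proof
  fix a b c :: R42 and s :: real
  show "lip (a + b) c = lip a c + lip b c" "lip a (b + c) = lip a b + lip a c"
    "lip (s *\<^sub>R a) b = s *\<^sub>R lip a b" "lip a (s *\<^sub>R b) = s *\<^sub>R lip a b"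
    by (simp_all add: lip_simps)
  have "\<bar>lip x y\<bar> \<le> norm x * norm y * 2" for x y :: R42
  proof -
    have "\<bar>lip x y\<bar> \<le> \<bar>fst x \<bullet> fst y\<bar> + \<bar>snd x \<bullet> snd y\<bar>"
      unfolding lip_def by linarith
    also have "\<dots> \<le> norm (fst x) * norm (fst y) + norm (snd x) * norm (snd y)"
      by (intro add_mono Cauchy_Schwarz_ineq2)
    also have "\<dots> \<le> norm x * norm y + norm x * norm y"
      using norm_fst_le[of "fst x" "snd x"] norm_fst_le[of "fst y" "snd y"]
        norm_snd_le[of "snd x" "fst x"] norm_snd_le[of "snd y" "fst y"]
      by (intro add_mono mult_mono) simp_all
    finally show ?thesis by simp
  qed
  then show "\<exists>K. \<forall>a b. norm (lip a b) \<le> norm a * norm b * K"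
    by (metis real_norm_def)
qed

interpretation lip: bounded_bilinear lip
  by (rule bounded_bilinear_lip)

lemma lip_zero_span:
  assumes "x \<in> span B" "\<And>b. b \<in> B \<Longrightarrow> lip b y = 0"
  shows "lip x y = 0"
  using assms(1)
proof (induction rule: span_induct_alt)
  case base
  then show ?case by (simp add: lip.zero_left)
next
  case (step c b z)
  then show ?case using assms(2) by (simp add: lip_simps)
qed

lemma lip_nondegenerate:
  assumes "\<And>y. lip x y = 0"
  shows "x = 0"
proof -
  \<comment> \<open>Flipping the sign of the negative block of the test vector turns
    \<open>lip\<close> into the Euclidean square norm of \<open>x\<close>.\<close>
  have "fst x \<bullet> fst x + snd x \<bullet> snd x = 0"
    using assms[of "(fst x, - snd x)"] by (simp add: lip_def)
  then have "fst x = 0 \<and> snd x = 0"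
    by (metis add_nonneg_eq_0_iff inner_eq_zero_iff inner_ge_zero)
  then show ?thesis by (simp add: prod_eq_iff)
qed

lemma lip_orthogonal_sum:
  assumes "finite B" and orth: "\<And>x y. x \<in> B \<Longrightarrow> y \<in> B \<Longrightarrow> x \<noteq> y \<Longrightarrow> lip x y = 0"
  shows "b \<in> B \<Longrightarrow> lip (\<Sum>x\<in>B. u x *\<^sub>R x) b = u b * lip b b"
    and "lip (\<Sum>x\<in>B. u x *\<^sub>R x) (\<Sum>x\<in>B. u x *\<^sub>R x) = (\<Sum>b\<in>B. (u b)\<^sup>2 * lip b b)"
proof -
  have *: "lip (\<Sum>x\<in>B. u x *\<^sub>R x) b = u b * lip b b" if "b \<in> B" for b
  proof -
    have "lip (\<Sum>x\<in>B. u x *\<^sub>R x) b = (\<Sum>x\<in>B. u x * lip x b)"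
      by (simp add: lip.sum_left lip_simps)
    also have "\<dots> = (\<Sum>x\<in>B. if x = b then u b * lip b b else 0)"
      using orth that by (intro sum.cong) auto
    finally show ?thesis using assms(1) that by simp
  qed
  then show "b \<in> B \<Longrightarrow> lip (\<Sum>x\<in>B. u x *\<^sub>R x) b = u b * lip b b" .
  show "lip (\<Sum>x\<in>B. u x *\<^sub>R x) (\<Sum>x\<in>B. u x *\<^sub>R x) = (\<Sum>b\<in>B. (u b)\<^sup>2 * lip b b)"
    by (subst lip.sum_right, intro sum.cong) (simp_all add: lip_simps * power2_eq_square)
qed

lemma lip_orthogonal_independent:
  assumes "finite B" and orth: "\<And>x y. x \<in> B \<Longrightarrow> y \<in> B \<Longrightarrow> x \<noteq> y \<Longrightarrow> lip x y = 0"
    and nz: "\<And>x. x \<in> B \<Longrightarrow> lip x x \<noteq> 0"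
  shows "independent B"
  unfolding dependent_finite[OF assms(1)]
proof clarify
  fix u b assume 0: "(\<Sum>v\<in>B. u v *\<^sub>R v) = 0" and b: "b \<in> B" "u b \<noteq> 0"
  then show False
    using lip_orthogonal_sum(1)[OF assms(1) orth b(1), of u] nz[OF b(1)]
    by (simp add: lip.zero_left)
qed

lemma lip_orthogonal_span_UNIV:
  assumes "finite B" "card B = 6" and "\<And>x y. x \<in> B \<Longrightarrow> y \<in> B \<Longrightarrow> x \<noteq> y \<Longrightarrow> lip x y = 0"
    and "\<And>x. x \<in> B \<Longrightarrow> lip x x \<noteq> 0"
  shows "span B = UNIV"
proof -
  have "independent B" by (rule lip_orthogonal_independent[OF assms(1,3,4)])
  moreover have "dim (UNIV :: R42 set) \<le> card B"
    using assms(2) by (simp add: dim_UNIV)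
  ultimately have "(UNIV :: R42 set) \<subseteq> span B"
    by (intro card_ge_dim_independent) auto
  then show ?thesis by blast
qed

text \<open>One half of Sylvester's law of inertia. The form times \<open>s\<close> is negative
  definite on \<open>span B\<close> and nonnegative on the kernel of \<open>L\<close>, so
  \<open>L\<close> is injective on \<open>span B\<close>. Taking \<open>L\<close> as the projection
  to one block, with the matching sign \<open>s\<close>, bounds the number of negative or positive
  vectors.\<close>

lemma card_definite_le:
  fixes L :: "R42 \<Rightarrow> 'b::euclidean_space"
  assumes "linear L" and ker: "\<And>x. L x = 0 \<Longrightarrow> s * lip x x \<ge> 0"
    and "finite B" and orth: "\<And>x y. x \<in> B \<Longrightarrow> y \<in> B \<Longrightarrow> x \<noteq> y \<Longrightarrow> lip x y = 0"
    and neg: "\<And>x. x \<in> B \<Longrightarrow> s * lip x x < 0"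
  shows "card B \<le> DIM('b)"
proof -
  have "lip x x \<noteq> 0" if "x \<in> B" for x
    using neg[OF that] by auto
  then have ind: "independent B"
    using lip_orthogonal_independent[OF assms(3) orth] by simp
  have "x = 0" if x: "x \<in> span B" "L x = 0" for x
  proof -
    obtain u where u: "x = (\<Sum>b\<in>B. u b *\<^sub>R b)"
      using x(1) span_finite[OF assms(3)] by auto
    have "lip x x = (\<Sum>b\<in>B. (u b)\<^sup>2 * lip b b)"
      unfolding u by (rule lip_orthogonal_sum(2)[OF assms(3) orth])
    then have "s * lip x x = (\<Sum>b\<in>B. (u b)\<^sup>2 * (s * lip b b))"
      by (simp add: sum_distrib_left mult.left_commute)
    then have ge: "(\<Sum>b\<in>B. (u b)\<^sup>2 * (- (s * lip b b))) \<le> 0"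
      using ker[OF x(2)] by (simp add: sum_negf)
    have nonneg: "(u b)\<^sup>2 * (- (s * lip b b)) \<ge> 0" if "b \<in> B" for b
      using neg[OF that] by (intro mult_nonneg_nonneg) auto
    have "(\<Sum>b\<in>B. (u b)\<^sup>2 * (- (s * lip b b))) = 0"
      using ge nonneg by (intro antisym sum_nonneg) auto
    then have "\<forall>b\<in>B. (u b)\<^sup>2 * (- (s * lip b b)) = 0"
      using sum_nonneg_eq_0_iff[OF assms(3) nonneg] by simp
    then have "u b = 0" if "b \<in> B" for b
      using neg[OF that] that by auto
    then show ?thesis unfolding u by simp
  qed
  then have inj: "inj_on L (span B)"
    by (simp add: linear_inj_on_iff_eq_0[OF assms(1) subspace_span])
  have "card (L ` B) = card B"
    by (rule card_image[OF inj_on_subset[OF inj span_superset]])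
  moreover have "independent (L ` B)"
    by (rule linear_independent_injective_image[OF assms(1) ind inj])
  ultimately show ?thesis
    using independent_bound[of "L ` B"] by simp
qed

lemma card_negative_le:
  assumes "finite B" "\<And>x y. x \<in> B \<Longrightarrow> y \<in> B \<Longrightarrow> x \<noteq> y \<Longrightarrow> lip x y = 0" "\<And>x. x \<in> B \<Longrightarrow> lip x x < 0"
  shows "card B \<le> 2"
  using card_definite_le[of snd 1 B] assms by (simp add: linear_snd lip_def)

lemma card_positive_le:
  assumes "finite B" "\<And>x y. x \<in> B \<Longrightarrow> y \<in> B \<Longrightarrow> x \<noteq> y \<Longrightarrow> lip x y = 0" "\<And>x. x \<in> B \<Longrightarrow> lip x x > 0"
  shows "card B \<le> 4"
  using card_definite_le[of fst "-1" B] assms by (simp add: linear_fst lip_def)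

lemma in_span_pair: "x \<in> span {a, b} \<longleftrightarrow> (\<exists>u v. x = u *\<^sub>R a + v *\<^sub>R b)"
  for a b :: "'a::real_vector"
proof -
  have "x \<in> span {a, b} \<longleftrightarrow> (\<exists>u v. x - u *\<^sub>R a = v *\<^sub>R b)"
    by (auto simp: span_insert[of a "{b}"] span_singleton)
  then show ?thesis by (simp add: diff_eq_eq add.commute)
qed

text \<open>Gram determinants of two bases of a plane differ by the squared determinant of the
  change of basis, and that of \<open>p, q\<close> is \<open>- lip q q\<close>. The product with
  \<open>lip q q\<close> is therefore minus a nonzero square.\<close>

lemma gram_det_plane:
  assumes "span {pp, pm} = span {p, q}" "lip p p = -1" "lip p q = 0" "lip q q \<noteq> 0"
  shows "(lip pp pp * lip pm pm - (lip pp pm)\<^sup>2) * lip q q < 0"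
proof -
  have "pp \<in> span {p, q}" "pm \<in> span {p, q}" "p \<in> span {pp, pm}" "q \<in> span {pp, pm}"
    using assms(1) by (metis insertI1 insertI2 span_base)+
  then obtain a b c e x y z w where
    pp: "pp = a *\<^sub>R p + b *\<^sub>R q" and pm: "pm = c *\<^sub>R p + e *\<^sub>R q"
    and p: "p = x *\<^sub>R pp + y *\<^sub>R pm" and q: "q = z *\<^sub>R pp + w *\<^sub>R pm"
    unfolding in_span_pair by blast
  have qp: "lip q p = 0" using assms(3) lip_commute by metis
  note l = lip_simps assms(2,3) qp
  have P: "lip pp p = - a" "lip pp q = b * lip q q" "lip pm p = - c" "lip pm q = e * lip q q"
    by (simp_all add: pp pm l)
  have "x * a + y * c = 1"
    using arg_cong[OF p, of "\<lambda>v. lip v p"] by (simp add: l P)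
  moreover have "(x * b + y * e) * lip q q = 0"
    using arg_cong[OF p, of "\<lambda>v. lip v q"] by (simp add: l P algebra_simps)
  then have "x * b + y * e = 0" using assms(4) by simp
  moreover have "z * a + w * c = 0"
    using arg_cong[OF q, of "\<lambda>v. lip v p"] by (simp add: l P)
  moreover have "(z * b + w * e) * lip q q = lip q q"
    using arg_cong[OF q, of "\<lambda>v. lip v q"] by (simp add: l P algebra_simps)
  then have "z * b + w * e = 1" using assms(4) by simp
  \<comment> \<open>The two changes of basis are inverse to each other, so their determinants
    multiply to 1.\<close>
  ultimately have "(x * w - y * z) * (a * e - b * c) = 1"
    by algebra
  then have nz: "a * e - b * c \<noteq> 0" by auto
  have "(lip pp pp * lip pm pm - (lip pp pm)\<^sup>2) * lip q q = - (((a * e - b * c) * lip q q)\<^sup>2)"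
    by (simp add: pp pm l) algebra
  then show ?thesis using nz assms(4) by simp
qed

text \<open>The frame is left arbitrary so that every fact can be instantiated again with the moving
  frame at a point of the surface.\<close>

locale adapted =
  fixes pp pm p q v\<^sub>1 e\<^sub>1 v\<^sub>2 e\<^sub>2 :: R42 and \<kappa>\<^sub>1 \<kappa>\<^sub>2 :: real
  assumes basis: "adapted_basis pp pm v\<^sub>1 e\<^sub>1 v\<^sub>2 e\<^sub>2 \<kappa>\<^sub>1 \<kappa>\<^sub>2"
    and plane: "span {pp, pm} = span {p, q}" "lip p p = -1" "lip p q = 0" "lip q q \<noteq> 0"
begin

abbreviation "\<kappa>p \<equiv> lip pp pp"
abbreviation "\<kappa>m \<equiv> lip pm pm"
abbreviation "\<epsilon> \<equiv> lip pp pm"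
abbreviation "\<Delta> \<equiv> \<kappa>p * \<kappa>m - \<epsilon>\<^sup>2"

lemma \<kappa>_cases: "\<kappa>\<^sub>1 = 1 \<or> \<kappa>\<^sub>1 = -1" "\<kappa>\<^sub>2 = 1 \<or> \<kappa>\<^sub>2 = -1"
  using basis by (auto simp: adapted_basis_def)

lemma \<kappa>_square: "\<kappa>\<^sub>1 * \<kappa>\<^sub>1 = 1" "\<kappa>\<^sub>2 * \<kappa>\<^sub>2 = 1"
  using \<kappa>_cases by auto

lemma plane_orthogonal:
  assumes "x \<in> {p, q}" "y \<in> {v\<^sub>1, e\<^sub>1, v\<^sub>2, e\<^sub>2}"
  shows "lip x y = 0"
proof (rule lip_zero_span)
  show "x \<in> span {pp, pm}" using assms(1) plane(1) span_base by metis
  show "lip b y = 0" if "b \<in> {pp, pm}" for b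
    using basis assms(2) that unfolding adapted_basis_def by blast
qed

lemma lip_basis:
  "lip v\<^sub>1 v\<^sub>1 = \<kappa>\<^sub>1" "lip e\<^sub>1 e\<^sub>1 = 1" "lip v\<^sub>1 e\<^sub>1 = 0" "lip e\<^sub>1 v\<^sub>1 = 0"
  "lip v\<^sub>2 v\<^sub>2 = \<kappa>\<^sub>2" "lip e\<^sub>2 e\<^sub>2 = 1" "lip v\<^sub>2 e\<^sub>2 = 0" "lip e\<^sub>2 v\<^sub>2 = 0"
  "lip pp v\<^sub>1 = 0" "lip pp e\<^sub>1 = 0" "lip pp v\<^sub>2 = 0" "lip pp e\<^sub>2 = 0"
  "lip pm v\<^sub>1 = 0" "lip pm e\<^sub>1 = 0" "lip pm v\<^sub>2 = 0" "lip pm e\<^sub>2 = 0"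
  "lip v\<^sub>1 pp = 0" "lip e\<^sub>1 pp = 0" "lip v\<^sub>2 pp = 0" "lip e\<^sub>2 pp = 0"
  "lip v\<^sub>1 pm = 0" "lip e\<^sub>1 pm = 0" "lip v\<^sub>2 pm = 0" "lip e\<^sub>2 pm = 0"
  "lip v\<^sub>1 v\<^sub>2 = 0" "lip v\<^sub>1 e\<^sub>2 = 0" "lip e\<^sub>1 v\<^sub>2 = 0" "lip e\<^sub>1 e\<^sub>2 = 0"
  "lip v\<^sub>2 v\<^sub>1 = 0" "lip e\<^sub>2 v\<^sub>1 = 0" "lip v\<^sub>2 e\<^sub>1 = 0" "lip e\<^sub>2 e\<^sub>1 = 0"
  "lip pm pp = \<epsilon>"
  using basis
  by (simp_all add: adapted_basis_def
      lip_commute[of e\<^sub>1 v\<^sub>1] lip_commute[of e\<^sub>2 v\<^sub>2] lip_commute[of v\<^sub>1 pp] lip_commute[of e\<^sub>1 pp]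
      lip_commute[of v\<^sub>2 pp] lip_commute[of e\<^sub>2 pp] lip_commute[of v\<^sub>1 pm] lip_commute[of e\<^sub>1 pm]
      lip_commute[of v\<^sub>2 pm] lip_commute[of e\<^sub>2 pm] lip_commute[of v\<^sub>2 v\<^sub>1] lip_commute[of v\<^sub>2 e\<^sub>1]
      lip_commute[of e\<^sub>2 v\<^sub>1] lip_commute[of e\<^sub>2 e\<^sub>1] lip_commute[of pm pp])

lemma lip_plane:
  "lip p v\<^sub>1 = 0" "lip p e\<^sub>1 = 0" "lip p v\<^sub>2 = 0" "lip p e\<^sub>2 = 0"
  "lip q v\<^sub>1 = 0" "lip q e\<^sub>1 = 0" "lip q v\<^sub>2 = 0" "lip q e\<^sub>2 = 0"
  "lip v\<^sub>1 p = 0" "lip e\<^sub>1 p = 0" "lip v\<^sub>2 p = 0" "lip e\<^sub>2 p = 0"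
  "lip v\<^sub>1 q = 0" "lip e\<^sub>1 q = 0" "lip v\<^sub>2 q = 0" "lip e\<^sub>2 q = 0"
  "lip q p = 0"
  using plane(3)
  by (simp_all add: plane_orthogonal
      lip_commute[of v\<^sub>1 p] lip_commute[of e\<^sub>1 p] lip_commute[of v\<^sub>2 p] lip_commute[of e\<^sub>2 p]
      lip_commute[of v\<^sub>1 q] lip_commute[of e\<^sub>1 q] lip_commute[of v\<^sub>2 q] lip_commute[of e\<^sub>2 q]
      lip_commute[of q p])

lemmas lip_orthonormal = lip_basis(1-8,25-32) lip_plane plane(2,3)

lemma basis_distinct: "distinct [p, q, v\<^sub>1, e\<^sub>1, v\<^sub>2, e\<^sub>2]"
proof -
  have ne: "x \<noteq> y" if "lip x x \<noteq> 0" "lip x y = 0" for x y using that by auto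
  moreover have "\<kappa>\<^sub>1 \<noteq> 0" "\<kappa>\<^sub>2 \<noteq> 0" using \<kappa>_square by auto
  ultimately show ?thesis
    using plane(4) by (simp add: ne lip_orthonormal)
qed

lemma basis_ortho:
  "x \<in> {p, q, v\<^sub>1, e\<^sub>1, v\<^sub>2, e\<^sub>2} \<Longrightarrow> y \<in> {p, q, v\<^sub>1, e\<^sub>1, v\<^sub>2, e\<^sub>2} \<Longrightarrow> x \<noteq> y \<Longrightarrow> lip x y = 0"
  using lip_orthonormal by auto

lemma basis_span: "span {p, q, v\<^sub>1, e\<^sub>1, v\<^sub>2, e\<^sub>2} = UNIV"
proof (rule lip_orthogonal_span_UNIV)
  show "card {p, q, v\<^sub>1, e\<^sub>1, v\<^sub>2, e\<^sub>2} = 6"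
    using basis_distinct by simp
  show "lip x x \<noteq> 0" if "x \<in> {p, q, v\<^sub>1, e\<^sub>1, v\<^sub>2, e\<^sub>2}" for x
    using that lip_orthonormal plane(4) \<kappa>_cases by auto
qed (use basis_ortho in auto)

text \<open>Products with \<open>pp\<close> and \<open>pm\<close> control those with
  \<open>p\<close> and \<open>q\<close>, which lie in their span; a vector orthogonal to a whole
  basis vanishes by nondegeneracy.\<close>

lemma eq_0I:
  assumes "lip x pp = 0" "lip x pm = 0" "lip x v\<^sub>1 = 0" "lip x e\<^sub>1 = 0" "lip x v\<^sub>2 = 0" "lip x e\<^sub>2 = 0"
  shows "x = 0"
proof (rule lip_nondegenerate)
  fix y
  have "lip y x = 0"
  proof (rule lip_zero_span)
    show "y \<in> span {p, q, v\<^sub>1, e\<^sub>1, v\<^sub>2, e\<^sub>2}" by (simp add: basis_span)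
    fix b assume b: "b \<in> {p, q, v\<^sub>1, e\<^sub>1, v\<^sub>2, e\<^sub>2}"
    have *: "lip z x = 0" if "z \<in> {p, q}" for z
    proof (rule lip_zero_span)
      show "z \<in> span {pp, pm}" using that plane(1) span_base by metis
    qed (use assms lip_commute[of _ x] in auto)
    show "lip b x = 0"
      using b assms lip_commute[of _ x] *[of p] *[of q] by (elim insertE) simp_all
  qed
  then show "lip x y = 0" by (simp add: lip_commute[of x y])
qed

text \<open>The left side is the Gram determinant of the adapted basis, positive because the
  signature has two minus signs. The proof counts signs in the orthogonal basis
  \<open>p, q, v\<^sub>1, e\<^sub>1, v\<^sub>2, e\<^sub>2\<close>: at most two vectors are negative
  and at most four positive.\<close>

lemma \<Delta>_sign: "\<kappa>\<^sub>1 * \<kappa>\<^sub>2 * \<Delta> > 0"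
proof (cases "lip q q > 0")
  case True
  have "\<not> (\<kappa>\<^sub>1 = -1 \<and> \<kappa>\<^sub>2 = -1)"
  proof
    assume "\<kappa>\<^sub>1 = -1 \<and> \<kappa>\<^sub>2 = -1"
    then have "card {p, v\<^sub>1, v\<^sub>2} \<le> 2"
      using lip_orthonormal by (intro card_negative_le) auto
    then show False using basis_distinct by simp
  qed
  moreover have "\<not> (\<kappa>\<^sub>1 = 1 \<and> \<kappa>\<^sub>2 = 1)"
  proof
    assume "\<kappa>\<^sub>1 = 1 \<and> \<kappa>\<^sub>2 = 1"
    then have "card {q, v\<^sub>1, e\<^sub>1, v\<^sub>2, e\<^sub>2} \<le> 4"
      using lip_orthonormal True by (intro card_positive_le) auto
    then show False using basis_distinct by simp
  qed
  ultimately have "\<kappa>\<^sub>1 * \<kappa>\<^sub>2 = -1" using \<kappa>_cases by auto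
  moreover have "\<Delta> < 0" using gram_det_plane[OF plane] True by (simp add: mult_less_0_iff)
  ultimately show ?thesis by simp
next
  case False
  then have neg: "lip q q < 0" using plane(4) by simp
  have "\<kappa>\<^sub>1 \<noteq> -1"
  proof
    assume "\<kappa>\<^sub>1 = -1"
    then have "card {p, q, v\<^sub>1} \<le> 2"
      using lip_orthonormal neg by (intro card_negative_le) auto
    then show False using basis_distinct by simp
  qed
  moreover have "\<kappa>\<^sub>2 \<noteq> -1"
  proof
    assume "\<kappa>\<^sub>2 = -1"
    then have "card {p, q, v\<^sub>2} \<le> 2"
      using lip_orthonormal neg by (intro card_negative_le) auto
    then show False using basis_distinct by simp
  qed
  ultimately have "\<kappa>\<^sub>1 = 1" "\<kappa>\<^sub>2 = 1" using \<kappa>_cases by auto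
  moreover have "\<Delta> > 0" using gram_det_plane[OF plane] neg by (simp add: mult_less_0_iff)
  ultimately show ?thesis by simp
qed

end

section \<open>Rotating frames\<close>

definition rot_v :: "real \<Rightarrow> R42 \<Rightarrow> R42 \<Rightarrow> real \<Rightarrow> R42" where
  "rot_v \<kappa> v e \<theta> = cs \<kappa> \<theta> *\<^sub>R v + sn \<kappa> \<theta> *\<^sub>R e"

text \<open>This is both the rotated \<open>e\<close> and the derivative of \<open>rot_v\<close>;
  the factor \<kappa> treats circular and hyperbolic rotations alike.\<close>

definition rot_e :: "real \<Rightarrow> R42 \<Rightarrow> R42 \<Rightarrow> real \<Rightarrow> R42" where
  "rot_e \<kappa> v e \<theta> = - (\<kappa> * sn \<kappa> \<theta>) *\<^sub>R v + cs \<kappa> \<theta> *\<^sub>R e"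

lemma cs_sn_DERIV:
  assumes "\<kappa> = 1 \<or> \<kappa> = -1"
  shows "(cs \<kappa> has_real_derivative - (\<kappa> * sn \<kappa> \<theta>)) (at \<theta>)"
    and "(sn \<kappa> has_real_derivative cs \<kappa> \<theta>) (at \<theta>)"
proof -
  have "cs 1 = cos" "sn 1 = sin" "cs (-1) = cosh" "sn (-1) = sinh"
    by (auto simp: cs_def sn_def)
  then show "(cs \<kappa> has_real_derivative - (\<kappa> * sn \<kappa> \<theta>)) (at \<theta>)"
    "(sn \<kappa> has_real_derivative cs \<kappa> \<theta>) (at \<theta>)"
    using assms by (auto intro!: derivative_eq_intros)
qed

lemma scaleR_const_deriv:
  assumes "(f has_real_derivative f') (at x)"
  shows "((\<lambda>x. f x *\<^sub>R c) has_vector_derivative f' *\<^sub>R c) (at x)"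
  using has_vector_derivative_scaleR[OF assms has_vector_derivative_const[where c = c]] by simp

lemma rot_v_deriv:
  assumes "\<kappa> = 1 \<or> \<kappa> = -1"
  shows "(rot_v \<kappa> v e has_vector_derivative rot_e \<kappa> v e \<theta>) (at \<theta>)"
  unfolding rot_v_def[abs_def] rot_e_def
  by (intro has_vector_derivative_add scaleR_const_deriv) (rule cs_sn_DERIV[OF assms])+

lemma rot_e_deriv:
  assumes "\<kappa> = 1 \<or> \<kappa> = -1"
  shows "(rot_e \<kappa> v e has_vector_derivative (- \<kappa>) *\<^sub>R rot_v \<kappa> v e \<theta>) (at \<theta>)"
proof -
  have "(rot_e \<kappa> v e has_vector_derivative
      (- (\<kappa> * cs \<kappa> \<theta>)) *\<^sub>R v + (- (\<kappa> * sn \<kappa> \<theta>)) *\<^sub>R e) (at \<theta>)"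
    unfolding rot_e_def[abs_def]
    by (intro has_vector_derivative_add scaleR_const_deriv DERIV_minus DERIV_cmult cs_sn_DERIV[OF assms])
  then show ?thesis by (simp add: rot_v_def algebra_simps)
qed

text \<open>Links the partial derivatives in the Christoffel duality with the Frechet derivatives in
  the contact condition.\<close>

lemma partial_deriv:
  fixes f :: "real \<times> real \<Rightarrow> 'b::real_normed_vector"
  assumes "f differentiable at (a, b)"
  shows partial_u_deriv: "((\<lambda>u. f (u, b)) has_vector_derivative frechet_derivative f (at (a, b)) (1, 0)) (at a)"
    and partial_v_deriv: "((\<lambda>v. f (a, v)) has_vector_derivative frechet_derivative f (at (a, b)) (0, 1)) (at b)"
proof -
  let ?L = "frechet_derivative f (at (a, b))"
  have D: "(f has_derivative ?L) (at (a, b))"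
    using assms frechet_derivative_works by blast
  have lin: "?L (h *\<^sub>R x) = h *\<^sub>R ?L x" for h x
    by (rule linear_scale[OF has_derivative_linear[OF D]])
  have "((\<lambda>u. f (u, b)) has_derivative (\<lambda>h. ?L (h, 0))) (at a)"
    by (rule has_derivative_compose[OF has_derivative_Pair[OF has_derivative_ident has_derivative_const] D])
  moreover have "(\<lambda>h. ?L (h, 0)) = (\<lambda>h. h *\<^sub>R ?L (1, 0))"
    by (rule ext) (use lin[of _ "(1, 0)"] in \<open>metis mult.right_neutral mult_zero_right real_scaleR_def scaleR_Pair\<close>)
  ultimately show "((\<lambda>u. f (u, b)) has_vector_derivative ?L (1, 0)) (at a)"
    by (simp add: has_vector_derivative_def)
  have "((\<lambda>v. f (a, v)) has_derivative (\<lambda>h. ?L (0, h))) (at b)"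
    by (rule has_derivative_compose[OF has_derivative_Pair[OF has_derivative_const has_derivative_ident] D])
  moreover have "(\<lambda>h. ?L (0, h)) = (\<lambda>h. h *\<^sub>R ?L (0, 1))"
    by (rule ext) (use lin[of _ "(0, 1)"] in \<open>metis mult.right_neutral mult_zero_right real_scaleR_def scaleR_Pair\<close>)
  ultimately show "((\<lambda>v. f (a, v)) has_vector_derivative ?L (0, 1)) (at b)"
    by (simp add: has_vector_derivative_def)
qed

text \<open>A section \<open>f\<close> is \<open>a\<^sub>1 f\<^sub>1 + a\<^sub>2 f\<^sub>2\<close> in a local frame. Differentiating \<open>lip f f\<^sub>i = 0\<close> instead of
  this expression avoids the question whether the coefficients are differentiable.\<close>

lemma legendre_contact:
  assumes leg: "legendre_immersion S \<Lambda>" and x: "x \<in> S"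
    and f: "\<And>y. y \<in> S \<Longrightarrow> f y \<in> \<Lambda> y" "f differentiable at x"
    and g: "g \<in> \<Lambda> x"
  shows "lip (frechet_derivative f (at x) X) g = 0"
proof -
  have iso: "lip a b = 0" if "y \<in> S" "a \<in> \<Lambda> y" "b \<in> \<Lambda> y" for a b y
    using leg that unfolding legendre_immersion_def isotropic_def by blast
  obtain U f\<^sub>1 f\<^sub>2 where U: "open U" "x \<in> U" "U \<subseteq> S" and sm: "smooth_on U f\<^sub>1" "smooth_on U f\<^sub>2"
    and sp: "\<And>y. y \<in> U \<Longrightarrow> \<Lambda> y = span {f\<^sub>1 y, f\<^sub>2 y}"
    and c: "\<And>X. lip (frechet_derivative f\<^sub>1 (at x) X) (f\<^sub>2 x) = 0"
    using leg x unfolding legendre_immersion_def by metis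
  have prod: "lip (frechet_derivative h (at x) X) (k x) + lip (h x) (frechet_derivative k (at x) X) = 0"
    if "h differentiable at x" "k differentiable at x"
      and hk: "\<And>y. y \<in> U \<Longrightarrow> h y \<in> \<Lambda> y" "\<And>y. y \<in> U \<Longrightarrow> k y \<in> \<Lambda> y" for h k
  proof -
    have "(h has_derivative frechet_derivative h (at x)) (at x)"
      "(k has_derivative frechet_derivative k (at x)) (at x)"
      using that(1,2) frechet_derivative_works by blast+
    then have D: "((\<lambda>y. lip (h y) (k y)) has_derivative
        (\<lambda>X. lip (h x) (frechet_derivative k (at x) X) + lip (frechet_derivative h (at x) X) (k x))) (at x)"
      by (rule lip.FDERIV)
    have "((\<lambda>y. lip (h y) (k y)) has_derivative (\<lambda>X. 0)) (at x)"
      by (rule has_derivative_transform_within_open[OF has_derivative_const[of 0] U(1,2)])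
        (metis iso[OF _ hk] U(3) subsetD)
    then have "(\<lambda>X. lip (h x) (frechet_derivative k (at x) X) + lip (frechet_derivative h (at x) X) (k x))
        = (\<lambda>X. 0)"
      using has_derivative_unique[OF D] by blast
    from fun_cong[OF this, of X] show ?thesis by simp
  qed
  have F: "f\<^sub>1 y \<in> \<Lambda> y" "f\<^sub>2 y \<in> \<Lambda> y" "f y \<in> \<Lambda> y" if "y \<in> U" for y
    using f(1)[OF subsetD[OF U(3) that]] by (simp_all add: sp[OF that] span_base)
  note d1 = smooth_on_differentiable[OF U(1) sm(1) U(2)]
    and d2 = smooth_on_differentiable[OF U(1) sm(2) U(2)]
  \<comment> \<open>The contact condition gives one product of a frame vector with a derivative;
    differentiating isotropy gives the other three.\<close>
  have "lip (f\<^sub>2 x) (frechet_derivative f\<^sub>1 (at x) X) = 0"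
    using c[of X] lip_commute by metis
  moreover have "lip (f\<^sub>1 x) (frechet_derivative f\<^sub>2 (at x) X) = 0"
    using prod[OF d1 d2 F(1,2)] c[of X] by simp
  moreover have "lip (f\<^sub>1 x) (frechet_derivative f\<^sub>1 (at x) X) = 0"
    using prod[OF d1 d1 F(1,1)] lip_commute[of "frechet_derivative f\<^sub>1 (at x) X"] by simp
  moreover have "lip (f\<^sub>2 x) (frechet_derivative f\<^sub>2 (at x) X) = 0"
    using prod[OF d2 d2 F(2,2)] lip_commute[of "frechet_derivative f\<^sub>2 (at x) X"] by simp
  moreover obtain a\<^sub>1 a\<^sub>2 where "f x = a\<^sub>1 *\<^sub>R f\<^sub>1 x + a\<^sub>2 *\<^sub>R f\<^sub>2 x"
    using F(3)[OF U(2)] sp[OF U(2)] in_span_pair by blast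
  ultimately have "lip (f x) (frechet_derivative f\<^sub>1 (at x) X) = 0"
    "lip (f x) (frechet_derivative f\<^sub>2 (at x) X) = 0"
    by (simp_all add: lip_simps)
  then have 0: "lip (f\<^sub>1 x) (frechet_derivative f (at x) X) = 0"
    "lip (f\<^sub>2 x) (frechet_derivative f (at x) X) = 0"
    using prod[OF f(2) d1 F(3,1)] prod[OF f(2) d2 F(3,2)]
      lip_commute[of "frechet_derivative f (at x) X"] by simp_all
  have "g \<in> span {f\<^sub>1 x, f\<^sub>2 x}" using g sp[OF U(2)] by simp
  then have "lip g (frechet_derivative f (at x) X) = 0"
    by (rule lip_zero_span) (use 0 in auto)
  then show ?thesis by (simp add: lip_commute[of _ g])
qed

context adapted begin

text \<open>Rotations within the two planes preserve all products, so the locale applies to the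
  moving frame, in which s+ has coordinates \<open>r\<close>, \<open>d\<close> and 0.\<close>

lemma adapted_rotated:
  "adapted pp pm p q (rot_v \<kappa>\<^sub>1 v\<^sub>1 e\<^sub>1 \<theta>) (rot_e \<kappa>\<^sub>1 v\<^sub>1 e\<^sub>1 \<theta>) (rot_v \<kappa>\<^sub>2 v\<^sub>2 e\<^sub>2 \<eta>) (rot_e \<kappa>\<^sub>2 v\<^sub>2 e\<^sub>2 \<eta>) \<kappa>\<^sub>1 \<kappa>\<^sub>2"
proof
  have c: "cs \<kappa>\<^sub>1 \<theta> * cs \<kappa>\<^sub>1 \<theta> = 1 - \<kappa>\<^sub>1 * (sn \<kappa>\<^sub>1 \<theta> * sn \<kappa>\<^sub>1 \<theta>)"
    "cs \<kappa>\<^sub>2 \<eta> * cs \<kappa>\<^sub>2 \<eta> = 1 - \<kappa>\<^sub>2 * (sn \<kappa>\<^sub>2 \<eta> * sn \<kappa>\<^sub>2 \<eta>)"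
    using cs_sn(3) \<kappa>_cases by blast+
  have "cs \<kappa>\<^sub>1 \<theta> * (cs \<kappa>\<^sub>1 \<theta> * \<kappa>\<^sub>1) + sn \<kappa>\<^sub>1 \<theta> * sn \<kappa>\<^sub>1 \<theta> = \<kappa>\<^sub>1"
    "\<kappa>\<^sub>1 * sn \<kappa>\<^sub>1 \<theta> * (\<kappa>\<^sub>1 * sn \<kappa>\<^sub>1 \<theta> * \<kappa>\<^sub>1) + cs \<kappa>\<^sub>1 \<theta> * cs \<kappa>\<^sub>1 \<theta> = 1"
    "cs \<kappa>\<^sub>2 \<eta> * (cs \<kappa>\<^sub>2 \<eta> * \<kappa>\<^sub>2) + sn \<kappa>\<^sub>2 \<eta> * sn \<kappa>\<^sub>2 \<eta> = \<kappa>\<^sub>2"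
    "\<kappa>\<^sub>2 * sn \<kappa>\<^sub>2 \<eta> * (\<kappa>\<^sub>2 * sn \<kappa>\<^sub>2 \<eta> * \<kappa>\<^sub>2) + cs \<kappa>\<^sub>2 \<eta> * cs \<kappa>\<^sub>2 \<eta> = 1"
    "\<kappa>\<^sub>1 * sn \<kappa>\<^sub>1 \<theta> * (cs \<kappa>\<^sub>1 \<theta> * \<kappa>\<^sub>1) = sn \<kappa>\<^sub>1 \<theta> * cs \<kappa>\<^sub>1 \<theta>"
    "\<kappa>\<^sub>2 * sn \<kappa>\<^sub>2 \<eta> * (cs \<kappa>\<^sub>2 \<eta> * \<kappa>\<^sub>2) = sn \<kappa>\<^sub>2 \<eta> * cs \<kappa>\<^sub>2 \<eta>"
    using c \<kappa>_square by algebra+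
  then show "adapted_basis pp pm (rot_v \<kappa>\<^sub>1 v\<^sub>1 e\<^sub>1 \<theta>) (rot_e \<kappa>\<^sub>1 v\<^sub>1 e\<^sub>1 \<theta>)
      (rot_v \<kappa>\<^sub>2 v\<^sub>2 e\<^sub>2 \<eta>) (rot_e \<kappa>\<^sub>2 v\<^sub>2 e\<^sub>2 \<eta>) \<kappa>\<^sub>1 \<kappa>\<^sub>2"
    using \<kappa>_cases
    by (simp add: adapted_basis_def rot_v_def rot_e_def lip_simps lip.minus_left lip.minus_right
        lip_basis algebra_simps)
qed (fact plane)+

lemma rotation_polar:
  assumes "\<forall>b\<in>{v\<^sub>1, e\<^sub>1, v\<^sub>2, e\<^sub>2}. lip x b = 0"
  shows "rotation \<kappa>\<^sub>1 v\<^sub>1 e\<^sub>1 \<theta> (rotation \<kappa>\<^sub>2 v\<^sub>2 e\<^sub>2 \<eta> (x + a *\<^sub>R v\<^sub>1 + b *\<^sub>R v\<^sub>2))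
    = x + a *\<^sub>R rot_v \<kappa>\<^sub>1 v\<^sub>1 e\<^sub>1 \<theta> + b *\<^sub>R rot_v \<kappa>\<^sub>2 v\<^sub>2 e\<^sub>2 \<eta>"
proof -
  have k: "\<kappa>\<^sub>2 * (b * \<kappa>\<^sub>2) = b" "\<kappa>\<^sub>1 * (a * \<kappa>\<^sub>1) = a" using \<kappa>_square by algebra+
  have 2: "rotation \<kappa>\<^sub>2 v\<^sub>2 e\<^sub>2 \<eta> (x + a *\<^sub>R v\<^sub>1 + b *\<^sub>R v\<^sub>2) = x + a *\<^sub>R v\<^sub>1 + b *\<^sub>R rot_v \<kappa>\<^sub>2 v\<^sub>2 e\<^sub>2 \<eta>"
    using assms by (simp add: k(1) rotation_def rot_v_def[symmetric] lip_simps lip_basis scaleR_diff_right)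
  have "lip (rot_v \<kappa>\<^sub>2 v\<^sub>2 e\<^sub>2 \<eta>) v\<^sub>1 = 0" "lip (rot_v \<kappa>\<^sub>2 v\<^sub>2 e\<^sub>2 \<eta>) e\<^sub>1 = 0"
    by (simp_all add: rot_v_def lip_simps lip_basis)
  then show ?thesis
    unfolding 2 using assms
    by (simp add: k(2) rotation_def rot_v_def[of \<kappa>\<^sub>1, symmetric] lip_simps lip_basis scaleR_diff_right)
qed

lemma lip_square_expansion:
  assumes "lip x pm = 0" "lip x pp = \<Delta>" "lip x e\<^sub>1 = 0"
  shows "lip x x = \<kappa>m * \<Delta> + \<kappa>\<^sub>1 * (lip x v\<^sub>1)\<^sup>2 + \<kappa>\<^sub>2 * (lip x v\<^sub>2)\<^sup>2 + (lip x e\<^sub>2)\<^sup>2"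
proof -
  \<comment> \<open>The expansion of \<open>x\<close> in the basis. The coefficients
    \<open>\<kappa>m\<close> and \<open>- \<epsilon>\<close> solve the conditions at
    \<open>pp\<close> and \<open>pm\<close> by Cramer's rule, the normalization \<Delta> cancelling
    the Gram determinant.\<close>
  let ?y = "\<kappa>m *\<^sub>R pp - \<epsilon> *\<^sub>R pm + (\<kappa>\<^sub>1 * lip x v\<^sub>1) *\<^sub>R v\<^sub>1 + (\<kappa>\<^sub>2 * lip x v\<^sub>2) *\<^sub>R v\<^sub>2 + lip x e\<^sub>2 *\<^sub>R e\<^sub>2"
  have "\<kappa>\<^sub>1 * lip x v\<^sub>1 * \<kappa>\<^sub>1 = lip x v\<^sub>1" "\<kappa>\<^sub>2 * lip x v\<^sub>2 * \<kappa>\<^sub>2 = lip x v\<^sub>2"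
    using \<kappa>_square by algebra+
  then have "x - ?y = 0"
    by (intro eq_0I) (simp_all add: lip_simps lip_basis assms power2_eq_square)
  then have "lip x x = lip x ?y" by (metis eq_iff_diff_eq_0)
  then show ?thesis by (simp add: lip_simps assms power2_eq_square)
qed

end

section \<open>The profile curve\<close>

text \<open>Completing the square: a quadratic that somewhere fails to have the strict sign of its
  leading coefficient has nonnegative discriminant. A nonreal root would make the discriminant the
  negative square \<open>- ((2 * a * Im z)\<^sup>2)\<close>.\<close>

lemma real_roots:
  fixes a b c x :: real and z :: complex
  assumes "a \<noteq> 0" "a * (a * x\<^sup>2 + b * x + c) \<le> 0" "of_real a * z\<^sup>2 + of_real b * z + of_real c = 0"
  shows "z \<in> \<real>"
proof -
  have "4 * (a * (a * x\<^sup>2 + b * x + c)) = (2 * a * x + b)\<^sup>2 - (b\<^sup>2 - 4 * a * c)"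
    by algebra
  then have disc: "b\<^sup>2 - 4 * a * c \<ge> 0" using assms(2) zero_le_power2[of "2 * a * x + b"] by linarith
  have "Re (of_real a * z\<^sup>2 + of_real b * z + of_real c) = 0" "Im (of_real a * z\<^sup>2 + of_real b * z + of_real c) = 0"
    by (simp_all only: assms(3)) simp_all
  then have re: "a * ((Re z)\<^sup>2 - (Im z)\<^sup>2) + b * Re z + c = 0" and im: "(2 * a * Re z + b) * Im z = 0"
    by (simp_all add: power2_eq_square algebra_simps)
  have "Im z = 0"
  proof (rule ccontr)
    assume nz: "Im z \<noteq> 0"
    then have "2 * a * Re z + b = 0" using im by simp
    then have "b\<^sup>2 - 4 * a * c = - ((2 * a * Im z)\<^sup>2)" using re by algebra
    then show False using disc nz assms(1) by simp
  qed
  then show ?thesis by (simp add: complex_is_Real_iff)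
qed

text \<open>Coordinates refer to the frame \<open>\<rho>\<^sup>1 v\<^sub>1, \<rho>\<^sup>2 v\<^sub>2, \<rho>\<^sup>2 e\<^sub>2\<close>: \<open>(x, y, w)\<close> is the derivative of \<open>s\<^sup>+\<close>
  along the profile curve, \<open>(r, d, 0)\<close> and \<open>(c, \<kappa>\<^sub>2 A, B)\<close> are the parts of \<open>s\<^sup>+\<close> and \<open>s\<^sup>-\<close>
  to which it is orthogonal, and \<open>N\<close> is their cross product.\<close>

lemma profile_tangent:
  fixes \<kappa>p \<kappa>m \<epsilon> \<Delta> \<kappa>\<^sub>1 \<kappa>\<^sub>2 r d c A B x y w :: real
  assumes k: "\<kappa>\<^sub>1 * \<kappa>\<^sub>1 = 1" "\<kappa>\<^sub>2 * \<kappa>\<^sub>2 = 1" and \<Delta>: "\<Delta> = \<kappa>p * \<kappa>m - \<epsilon>\<^sup>2" "\<Delta> \<noteq> 0"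
    and h1: "d * A = \<epsilon> * \<Delta> - \<kappa>\<^sub>1 * c * r"
    and h2: "\<kappa>\<^sub>1 * c * x + y * A + w * B = 0"
    and h3: "\<kappa>m * \<Delta> + \<kappa>\<^sub>1 * c\<^sup>2 + \<kappa>\<^sub>2 * A\<^sup>2 + B\<^sup>2 = 0"
    and h4: "\<kappa>p * \<Delta> + \<kappa>\<^sub>1 * r\<^sup>2 + \<kappa>\<^sub>2 * d\<^sup>2 = 0"
    and h5: "\<kappa>\<^sub>1 * r * x + \<kappa>\<^sub>2 * d * y = 0"
    and N: "N\<^sub>1 = \<kappa>\<^sub>2 * d * B" "N\<^sub>2 = - \<kappa>\<^sub>1 * r * B" "N\<^sub>3 = \<kappa>\<^sub>1 * \<kappa>\<^sub>2 * (\<kappa>\<^sub>2 * r * A - d * c)"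
    and \<mu>: "\<mu> = (\<kappa>\<^sub>1 * x * N\<^sub>1 + \<kappa>\<^sub>2 * y * N\<^sub>2 + w * N\<^sub>3) / (\<kappa>\<^sub>1 * \<kappa>\<^sub>2 * \<Delta> ^ 3)"
  shows "x = \<mu> * N\<^sub>1" "y = \<mu> * N\<^sub>2" "w = \<mu> * N\<^sub>3"
    and "\<kappa>\<^sub>1 * x\<^sup>2 + \<kappa>\<^sub>2 * y\<^sup>2 + w\<^sup>2 = \<mu>\<^sup>2 * (\<kappa>\<^sub>1 * \<kappa>\<^sub>2 * \<Delta> ^ 3)"
proof -
  have "(\<kappa>p * \<Delta>) * (\<kappa>m * \<Delta>) = (\<kappa>\<^sub>1 * r\<^sup>2 + \<kappa>\<^sub>2 * d\<^sup>2) * (\<kappa>\<^sub>1 * c\<^sup>2 + \<kappa>\<^sub>2 * A\<^sup>2 + B\<^sup>2)"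
    using h3 h4 by algebra
  moreover have "\<epsilon> * \<Delta> = d * A + \<kappa>\<^sub>1 * c * r" using h1 by simp
  moreover have "\<Delta> ^ 3 = (\<kappa>p * \<Delta>) * (\<kappa>m * \<Delta>) - (\<epsilon> * \<Delta>)\<^sup>2"
    unfolding \<Delta>(1) by algebra
  ultimately have D3: "\<Delta> ^ 3 = (\<kappa>\<^sub>1 * r\<^sup>2 + \<kappa>\<^sub>2 * d\<^sup>2) * (\<kappa>\<^sub>1 * c\<^sup>2 + \<kappa>\<^sub>2 * A\<^sup>2 + B\<^sup>2)
      - (d * A + \<kappa>\<^sub>1 * c * r)\<^sup>2"
    by simp
  \<comment> \<open>Lagrange's identity for the cross product; \<open>D3\<close> is the Gram
    determinant of its two factors.\<close>
  have NN: "\<kappa>\<^sub>1 * N\<^sub>1\<^sup>2 + \<kappa>\<^sub>2 * N\<^sub>2\<^sup>2 + N\<^sub>3\<^sup>2 = \<kappa>\<^sub>1 * \<kappa>\<^sub>2 * \<Delta> ^ 3"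
    unfolding D3 N using k by algebra
  \<comment> \<open>The tangent and N are orthogonal to the same two vectors, so they are parallel
    and their 2 by 2 minors vanish. Then \<open>\<mu>\<close> is the projection coefficient of the
    tangent onto N.\<close>
  have c12: "x * N\<^sub>2 = y * N\<^sub>1" and c13: "x * N\<^sub>3 = w * N\<^sub>1" and c23: "y * N\<^sub>3 = w * N\<^sub>2"
    unfolding N using k h2 h5 by algebra+
  have "\<kappa>\<^sub>1 \<noteq> 0" "\<kappa>\<^sub>2 \<noteq> 0" using k by auto
  then have nz: "\<kappa>\<^sub>1 * \<kappa>\<^sub>2 * \<Delta> ^ 3 \<noteq> 0" using \<Delta>(2) by simp
  have M: "\<mu> * (\<kappa>\<^sub>1 * \<kappa>\<^sub>2 * \<Delta> ^ 3) = \<kappa>\<^sub>1 * x * N\<^sub>1 + \<kappa>\<^sub>2 * y * N\<^sub>2 + w * N\<^sub>3"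
    unfolding \<mu> using nz by simp
  have "(x - \<mu> * N\<^sub>1) * (\<kappa>\<^sub>1 * \<kappa>\<^sub>2 * \<Delta> ^ 3) = 0" "(y - \<mu> * N\<^sub>2) * (\<kappa>\<^sub>1 * \<kappa>\<^sub>2 * \<Delta> ^ 3) = 0"
    "(w - \<mu> * N\<^sub>3) * (\<kappa>\<^sub>1 * \<kappa>\<^sub>2 * \<Delta> ^ 3) = 0"
    using M NN c12 c13 c23 by algebra+
  then show "x = \<mu> * N\<^sub>1" "y = \<mu> * N\<^sub>2" "w = \<mu> * N\<^sub>3" using nz by auto
  then show "\<kappa>\<^sub>1 * x\<^sup>2 + \<kappa>\<^sub>2 * y\<^sup>2 + w\<^sup>2 = \<mu>\<^sup>2 * (\<kappa>\<^sub>1 * \<kappa>\<^sub>2 * \<Delta> ^ 3)"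
    using NN by algebra
qed

text \<open>The factor \<open>r\<close> clears the quotient \<open>C / r\<close>. The factor
  \<open>d\<close> turns \<open>A\<close> into \<open>d * A\<close>, known from \<open>h1\<close>,
  and leaves \<open>d\<close> only as a square, known from \<open>h4\<close>; \<open>h3\<close>
  eliminates \<open>B\<close>. This is how p_C arises without division by \<open>d\<close>.\<close>

lemma profile_equations:
  fixes \<kappa>p \<kappa>m \<epsilon> \<Delta> \<kappa>\<^sub>1 \<kappa>\<^sub>2 r d C A B :: real
  assumes k: "\<kappa>\<^sub>1 * \<kappa>\<^sub>1 = 1" "\<kappa>\<^sub>2 * \<kappa>\<^sub>2 = 1" and \<Delta>: "\<Delta> = \<kappa>p * \<kappa>m - \<epsilon>\<^sup>2" and r: "r \<noteq> 0"
    and h1: "d * A = \<epsilon> * \<Delta> - \<kappa>\<^sub>1 * C"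
    and h3: "\<kappa>m * \<Delta> + \<kappa>\<^sub>1 * (C / r)\<^sup>2 + \<kappa>\<^sub>2 * A\<^sup>2 + B\<^sup>2 = 0"
    and h4: "\<kappa>p * \<Delta> + \<kappa>\<^sub>1 * r\<^sup>2 + \<kappa>\<^sub>2 * d\<^sup>2 = 0"
  shows "(r * d * B)\<^sup>2 = \<kappa>\<^sub>2 * \<Delta> * poly (profile_poly \<kappa>p \<kappa>m \<epsilon> \<Delta> \<kappa>\<^sub>1 C) (r\<^sup>2)"
    and "r * d * (\<kappa>\<^sub>1 * \<kappa>\<^sub>2 * (\<kappa>\<^sub>2 * r * A - d * (C / r))) = \<kappa>\<^sub>1 * \<Delta> * (\<epsilon> * r\<^sup>2 + \<kappa>p * C)"
proof -
  have Cr: "r * (C / r) = C" using r by simp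
  have p: "poly (profile_poly \<kappa>p \<kappa>m \<epsilon> \<Delta> \<kappa>\<^sub>1 C) (r\<^sup>2)
      = \<kappa>\<^sub>1 * \<kappa>p * C\<^sup>2 + r\<^sup>2 * (\<Delta>\<^sup>2 + 2 * \<kappa>\<^sub>1 * \<epsilon> * C + r\<^sup>2 * (\<kappa>\<^sub>1 * \<kappa>m))"
    by (simp add: profile_poly_def)
  have "\<kappa>m * \<Delta> * r\<^sup>2 + \<kappa>\<^sub>1 * C\<^sup>2 + \<kappa>\<^sub>2 * A\<^sup>2 * r\<^sup>2 + B\<^sup>2 * r\<^sup>2 = 0"
    using h3 Cr by algebra
  then have "(r * d * B)\<^sup>2 = - (\<kappa>m * \<Delta> * r\<^sup>2 + \<kappa>\<^sub>1 * C\<^sup>2) * d\<^sup>2 - \<kappa>\<^sub>2 * (d * A)\<^sup>2 * r\<^sup>2"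
    by algebra
  also have "d\<^sup>2 = - \<kappa>\<^sub>2 * (\<kappa>p * \<Delta> + \<kappa>\<^sub>1 * r\<^sup>2)"
    using h4 k by algebra
  also have "- (\<kappa>m * \<Delta> * r\<^sup>2 + \<kappa>\<^sub>1 * C\<^sup>2) * (- \<kappa>\<^sub>2 * (\<kappa>p * \<Delta> + \<kappa>\<^sub>1 * r\<^sup>2)) - \<kappa>\<^sub>2 * (d * A)\<^sup>2 * r\<^sup>2
    = \<kappa>\<^sub>2 * \<Delta> * poly (profile_poly \<kappa>p \<kappa>m \<epsilon> \<Delta> \<kappa>\<^sub>1 C) (r\<^sup>2)"
    unfolding h1 p using k \<Delta> by algebra
  finally show "(r * d * B)\<^sup>2 = \<kappa>\<^sub>2 * \<Delta> * poly (profile_poly \<kappa>p \<kappa>m \<epsilon> \<Delta> \<kappa>\<^sub>1 C) (r\<^sup>2)" .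
  show "r * d * (\<kappa>\<^sub>1 * \<kappa>\<^sub>2 * (\<kappa>\<^sub>2 * r * A - d * (C / r))) = \<kappa>\<^sub>1 * \<Delta> * (\<epsilon> * r\<^sup>2 + \<kappa>p * C)"
    using k h1 h4 Cr by algebra
qed

theorem proposition3p2:
  fixes \<Lambda> sp sm :: "real \<times> real \<Rightarrow> R42 set"
    and fp fm :: "real \<times> real \<Rightarrow> R42"
    and pp pm p q v\<^sub>1 e\<^sub>1 v\<^sub>2 e\<^sub>2 :: R42
    and I J :: "real set"
    and r \<psi> d V :: "real \<Rightarrow> real"
    and \<kappa>p \<kappa>m \<epsilon> \<Delta> \<kappa>\<^sub>1 \<kappa>\<^sub>2 C :: real
    and C\<^sub>1 C\<^sub>2 :: complex
  assumes intervals: "open_interval I" "open_interval J"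
    and weingarten: "linear_weingarten (I \<times> J) \<Lambda> sp sm pp pm p q"
    and curvature: "lip q q \<noteq> 0"
    and basis: "adapted_basis pp pm v\<^sub>1 e\<^sub>1 v\<^sub>2 e\<^sub>2 \<kappa>\<^sub>1 \<kappa>\<^sub>2"
    and constants: "\<kappa>p = lip pp pp" "\<kappa>m = lip pm pm" "\<epsilon> = lip pp pm" "\<Delta> = \<kappa>p * \<kappa>m - \<epsilon>\<^sup>2"
    and rotational: "rotational I J (rotation \<kappa>\<^sub>1 v\<^sub>1 e\<^sub>1) \<Lambda>"
    and \<kappa>m_nonzero: "\<kappa>m \<noteq> 0"
    and lifts: "lift (I \<times> J) sp fp" "lift (I \<times> J) sm fm"
    and dual: "christoffel_dual (I \<times> J) \<Lambda> C (\<lambda>_. 1) V fp fm"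
    and normalized:
      "\<And>w. w \<in> I \<times> J \<Longrightarrow> lip (fp w) pp = 0 \<and> lip (fp w) pm = \<Delta>"
      "\<And>w. w \<in> I \<times> J \<Longrightarrow> lip (fm w) pm = 0 \<and> lip (fm w) pp = \<Delta>"
    and smooth: "smooth_on J r" "smooth_on J \<psi>" "smooth_on J d"
    and polar: "\<And>\<theta> t. \<theta> \<in> I \<Longrightarrow> t \<in> J \<Longrightarrow> fp (\<theta>, t) =
      rotation \<kappa>\<^sub>1 v\<^sub>1 e\<^sub>1 \<theta> (rotation \<kappa>\<^sub>2 v\<^sub>2 e\<^sub>2 (\<psi> t)
        ((- \<epsilon>) *\<^sub>R pp + \<kappa>p *\<^sub>R pm + r t *\<^sub>R v\<^sub>1 + 0 *\<^sub>R e\<^sub>1 + d t *\<^sub>R v\<^sub>2 + 0 *\<^sub>R e\<^sub>2))"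
    and roots: "map_poly of_real (profile_poly \<kappa>p \<kappa>m \<epsilon> \<Delta> \<kappa>\<^sub>1 C)
      = smult (of_real (\<kappa>\<^sub>1 * \<kappa>m)) ([: - C\<^sub>1, 1 :] * [: - C\<^sub>2, 1 :])"
  shows "(\<kappa>p > 0 \<and> \<kappa>m > 0 \<or> C\<^sub>1 \<in> \<real> \<and> C\<^sub>2 \<in> \<real>) \<and>
    (\<exists>J' \<phi>. \<exists>\<sigma>\<in>{1, -1}. reparametrization J' J \<phi> \<and>
      (\<forall>\<tau>\<in>J'.
        complex_of_real ((deriv (r \<circ> \<phi>) \<tau>)\<^sup>2)
          = of_real (\<kappa>m / \<Delta>\<^sup>2) * (of_real ((r (\<phi> \<tau>))\<^sup>2) - C\<^sub>1) * (of_real ((r (\<phi> \<tau>))\<^sup>2) - C\<^sub>2) \<and>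
        (\<kappa>p * \<Delta> + \<kappa>\<^sub>1 * (r (\<phi> \<tau>))\<^sup>2 \<noteq> 0 \<longrightarrow>
          deriv (\<psi> \<circ> \<phi>) \<tau>
            = \<sigma> * (sqrt (\<kappa>\<^sub>1 * \<kappa>\<^sub>2 / \<Delta>)
                * ((\<epsilon> * (r (\<phi> \<tau>))\<^sup>2 + \<kappa>p * C) / (\<kappa>p * \<Delta> + \<kappa>\<^sub>1 * (r (\<phi> \<tau>))\<^sup>2)))) \<and>
        (d (\<phi> \<tau>))\<^sup>2 = - (\<kappa>p * \<Delta> + \<kappa>\<^sub>1 * (r (\<phi> \<tau>))\<^sup>2) / \<kappa>\<^sub>2))"
proof -
  have weingarten_data: "omega_surface (I \<times> J) \<Lambda> sp sm" "lip p p = -1" "lip p q = 0"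
    "span {pp, pm} = span {p, q}"
    using weingarten by (auto simp: linear_weingarten_def)
  interpret adapted pp pm p q v\<^sub>1 e\<^sub>1 v\<^sub>2 e\<^sub>2 \<kappa>\<^sub>1 \<kappa>\<^sub>2
    by unfold_locales (fact basis weingarten_data curvature)+
  have sign: "\<kappa>\<^sub>1 * \<kappa>\<^sub>2 * \<Delta> > 0"
    using \<Delta>_sign by (simp add: constants)
  have \<Delta>_nz: "\<Delta> \<noteq> 0" using sign by auto
  have IJ: "open I" "open J" "is_interval J" "I \<noteq> {}" "J \<noteq> {}"
    using intervals by (auto simp: open_interval_def)
  have opW: "open (I \<times> J)" using IJ by (intro open_Times)
  have leg: "legendre_immersion (I \<times> J) \<Lambda>"
    and env: "\<And>w. w \<in> I \<times> J \<Longrightarrow> sp w \<subseteq> \<Lambda> w" "\<And>w. w \<in> I \<times> J \<Longrightarrow> sm w \<subseteq> \<Lambda> w"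
    using weingarten_data(1) unfolding omega_surface_def envelopes_def by blast+
  have fp_\<Lambda>: "fp w \<in> \<Lambda> w" and fm_\<Lambda>: "fm w \<in> \<Lambda> w" if "w \<in> I \<times> J" for w
    using lifts env[OF that] that span_base[of _ "{fp w}"] span_base[of _ "{fm w}"]
    unfolding lift_def by blast+
  have iso: "lip a b = 0" if "w \<in> I \<times> J" "a \<in> \<Lambda> w" "b \<in> \<Lambda> w" for a b w
    using leg that unfolding legendre_immersion_def isotropic_def by blast
  have fp_diff: "fp differentiable at w" and fm_diff: "fm differentiable at w" if "w \<in> I \<times> J" for w
    using smooth_on_differentiable[OF opW _ that] lifts unfolding lift_def by blast+

  \<comment> \<open>The lifts and their derivatives in the rotating frame\<close>
  let ?P = "(- \<epsilon>) *\<^sub>R pp + \<kappa>p *\<^sub>R pm"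
  let ?v1 = "rot_v \<kappa>\<^sub>1 v\<^sub>1 e\<^sub>1" and ?e1 = "rot_e \<kappa>\<^sub>1 v\<^sub>1 e\<^sub>1"
  let ?v2 = "\<lambda>t. rot_v \<kappa>\<^sub>2 v\<^sub>2 e\<^sub>2 (\<psi> t)" and ?e2 = "\<lambda>t. rot_e \<kappa>\<^sub>2 v\<^sub>2 e\<^sub>2 (\<psi> t)"
  have fp: "fp (\<theta>, t) = ?P + r t *\<^sub>R ?v1 \<theta> + d t *\<^sub>R ?v2 t" if "\<theta> \<in> I" "t \<in> J" for \<theta> t
  proof -
    have "\<forall>b\<in>{v\<^sub>1, e\<^sub>1, v\<^sub>2, e\<^sub>2}. lip ?P b = 0"
      by (simp add: lip_simps lip_basis lip.minus_left)
    then show ?thesis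
      using polar[OF that] rotation_polar[of ?P \<theta> "\<psi> t" "r t" "d t"] by simp
  qed
  have fp_u: "frechet_derivative fp (at (\<theta>, t)) (1, 0) = r t *\<^sub>R ?e1 \<theta>"
    if "\<theta> \<in> I" "t \<in> J" for \<theta> t
  proof -
    have "((\<lambda>u. ?P + r t *\<^sub>R ?v1 u + d t *\<^sub>R ?v2 t) has_vector_derivative r t *\<^sub>R ?e1 \<theta>) (at \<theta>)"
      by (auto intro!: derivative_eq_intros rot_v_deriv[OF \<kappa>_cases(1)])
    then have "((\<lambda>u. fp (u, t)) has_vector_derivative r t *\<^sub>R ?e1 \<theta>) (at \<theta>)"
      by (rule has_vector_derivative_transform_within_open[OF _ IJ(1) that(1)])
        (simp add: fp that(2))
    then show ?thesis
      using partial_u_deriv[OF fp_diff[of "(\<theta>, t)"]] that vector_derivative_unique_at by blast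
  qed
  have DERIVs: "(r has_real_derivative deriv r t) (at t)" "(\<psi> has_real_derivative deriv \<psi> t) (at t)"
    "(d has_real_derivative deriv d t) (at t)" if "t \<in> J" for t
    using smooth_on_DERIV[OF IJ(2)] smooth that by blast+
  have fp_v: "frechet_derivative fp (at (\<theta>, t)) (0, 1)
      = deriv r t *\<^sub>R ?v1 \<theta> + deriv d t *\<^sub>R ?v2 t + (d t * deriv \<psi> t) *\<^sub>R ?e2 t"
    if "\<theta> \<in> I" "t \<in> J" for \<theta> t
  proof -
    have v2: "(?v2 has_vector_derivative deriv \<psi> t *\<^sub>R ?e2 t) (at t)"
      using vector_diff_chain_at[of \<psi> "deriv \<psi> t" t, OF _ rot_v_deriv[OF \<kappa>_cases(2)]]
        DERIVs(2)[OF that(2)]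
      by (simp add: has_real_derivative_iff_has_vector_derivative o_def)
    have "((\<lambda>v. ?P + r v *\<^sub>R ?v1 \<theta> + d v *\<^sub>R ?v2 v) has_vector_derivative
        0 + deriv r t *\<^sub>R ?v1 \<theta> + (d t *\<^sub>R (deriv \<psi> t *\<^sub>R ?e2 t) + deriv d t *\<^sub>R ?v2 t)) (at t)"
      using DERIVs[OF that(2)] v2
      by (intro has_vector_derivative_add has_vector_derivative_const scaleR_const_deriv
          has_vector_derivative_scaleR)
    then have "((\<lambda>v. ?P + r v *\<^sub>R ?v1 \<theta> + d v *\<^sub>R ?v2 v) has_vector_derivative
        deriv r t *\<^sub>R ?v1 \<theta> + deriv d t *\<^sub>R ?v2 t + (d t * deriv \<psi> t) *\<^sub>R ?e2 t) (at t)"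
      by (simp add: add.commute add.left_commute)
    then have "((\<lambda>v. fp (\<theta>, v)) has_vector_derivative
        deriv r t *\<^sub>R ?v1 \<theta> + deriv d t *\<^sub>R ?v2 t + (d t * deriv \<psi> t) *\<^sub>R ?e2 t) (at t)"
      by (rule has_vector_derivative_transform_within_open[OF _ IJ(2) that(2)])
        (simp add: fp that(1))
    then show ?thesis
      using partial_v_deriv[OF fp_diff[of "(\<theta>, t)"]] that vector_derivative_unique_at by blast
  qed
  have partials: "partial_u f w = frechet_derivative f (at w) (1, 0)"
    "partial_v f w = frechet_derivative f (at w) (0, 1)" if "f differentiable at w"
    for f :: "real \<times> real \<Rightarrow> R42" and w
    using partial_deriv[of f "fst w" "snd w"] that
    by (simp_all add: partial_u_def partial_v_def vector_derivative_at)
  have dualD: "lip (partial_u fp w) (partial_u fp w) \<noteq> 0" "lip (partial_v fp w) (partial_v fp w) \<noteq> 0"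
    "partial_u fm w = (C / lip (partial_u fp w) (partial_u fp w)) *\<^sub>R partial_u fp w"
    if "w \<in> I \<times> J" for w
    using dual that unfolding christoffel_dual_def by auto
  \<comment> \<open>The square length of the derivative along \<theta> is the square of
    \<open>r t\<close>, and duality makes it nonzero.\<close>
  have r_nz: "r t \<noteq> 0" if "t \<in> J" for t
  proof -
    obtain \<theta> where "\<theta> \<in> I" using IJ(4) by blast
    then show ?thesis
      using dualD(1)[of "(\<theta>, t)"] that fp_diff[of "(\<theta>, t)"] by (auto simp: partials fp_u lip.zero_left)
  qed
  have e1: "lip (?e1 \<theta>) (?e1 \<theta>) = 1" for \<theta>
    using adapted.lip_basis(2)[OF adapted_rotated] .
  have fm_e1: "lip (fm (\<theta>, t)) (?e1 \<theta>) = 0" if "\<theta> \<in> I" "t \<in> J" for \<theta> t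
  proof -
    have w: "(\<theta>, t) \<in> I \<times> J" using that by simp
    have "lip (r t *\<^sub>R ?e1 \<theta>) (fm (\<theta>, t)) = 0"
      using legendre_contact[OF leg w fp_\<Lambda> fp_diff[OF w] fm_\<Lambda>[OF w]] fp_u[OF that] by metis
    then show ?thesis using r_nz[OF that(2)] by (simp add: lip_simps lip_commute[of "?e1 \<theta>"])
  qed
  \<comment> \<open>Differentiate \<open>fm_e1\<close> along the rotation: the frame contributes
    \<open>- \<kappa>\<^sub>1\<close> times the wanted component, duality contributes
    \<open>C / r t\<close>, and the sum is 0.\<close>
  have fm_v1: "lip (fm (\<theta>, t)) (?v1 \<theta>) = \<kappa>\<^sub>1 * (C / r t)" if "\<theta> \<in> I" "t \<in> J" for \<theta> t
  proof -
    have w: "(\<theta>, t) \<in> I \<times> J" using that by simp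
    have "frechet_derivative fm (at (\<theta>, t)) (1, 0) = (C / r t) *\<^sub>R ?e1 \<theta>"
      using dualD(3)[OF w] r_nz[OF that(2)]
      by (simp add: partials fp_diff[OF w] fm_diff[OF w] fp_u[OF that] lip_simps e1)
    then have "((\<lambda>u. fm (u, t)) has_vector_derivative (C / r t) *\<^sub>R ?e1 \<theta>) (at \<theta>)"
      using partial_u_deriv[OF fm_diff[OF w]] by simp
    then have D: "((\<lambda>u. lip (fm (u, t)) (?e1 u)) has_vector_derivative
        lip (fm (\<theta>, t)) ((- \<kappa>\<^sub>1) *\<^sub>R ?v1 \<theta>) + lip ((C / r t) *\<^sub>R ?e1 \<theta>) (?e1 \<theta>)) (at \<theta>)"
      by (intro lip.has_vector_derivative rot_e_deriv[OF \<kappa>_cases(1)])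
    have "((\<lambda>u. lip (fm (u, t)) (?e1 u)) has_vector_derivative 0) (at \<theta>)"
      by (rule has_vector_derivative_transform_within_open[OF has_vector_derivative_const[of 0] IJ(1) that(1)])
        (simp add: fm_e1 that(2))
    then have "lip (fm (\<theta>, t)) ((- \<kappa>\<^sub>1) *\<^sub>R ?v1 \<theta>) + lip ((C / r t) *\<^sub>R ?e1 \<theta>) (?e1 \<theta>) = 0"
      using D vector_derivative_unique_at by blast
    then have "\<kappa>\<^sub>1 * lip (fm (\<theta>, t)) (?v1 \<theta>) = C / r t"
      by (simp add: lip_simps lip.minus_right e1)
    then show ?thesis using \<kappa>_square(1) by algebra
  qed

  \<comment> \<open>The functions \<open>r\<close>, \<open>d\<close>, \<open>\<psi>\<close> do not
    depend on the angle, so all relations can be read off along one profile curve.\<close>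
  obtain \<theta> where \<theta>: "\<theta> \<in> I" using IJ(4) by blast
  define A B where "A t = lip (fm (\<theta>, t)) (?v2 t)" and "B t = lip (fm (\<theta>, t)) (?e2 t)" for t
  \<comment> \<open>Sources of the relations: \<open>h1\<close>, \<open>h3\<close>,
    \<open>h4\<close> are isotropy of the contact element, \<open>h2\<close> and \<open>h5\<close>
    are contact of the tangent with s- and s+, and \<open>speed\<close> is the nonvanishing required
    by duality.\<close>
  have h1: "d t * A t = \<epsilon> * \<Delta> - \<kappa>\<^sub>1 * C"
    and h2: "\<kappa>\<^sub>1 * (C / r t) * deriv r t + deriv d t * A t + d t * deriv \<psi> t * B t = 0"
    and h3: "\<kappa>m * \<Delta> + \<kappa>\<^sub>1 * (C / r t)\<^sup>2 + \<kappa>\<^sub>2 * (A t)\<^sup>2 + (B t)\<^sup>2 = 0"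
    and h4: "\<kappa>p * \<Delta> + \<kappa>\<^sub>1 * (r t)\<^sup>2 + \<kappa>\<^sub>2 * (d t)\<^sup>2 = 0"
    and h5: "\<kappa>\<^sub>1 * r t * deriv r t + \<kappa>\<^sub>2 * d t * deriv d t = 0"
    and speed: "\<kappa>\<^sub>1 * (deriv r t)\<^sup>2 + \<kappa>\<^sub>2 * (deriv d t)\<^sup>2 + (d t * deriv \<psi> t)\<^sup>2 \<noteq> 0"
    if t: "t \<in> J" for t
  proof -
    have w: "(\<theta>, t) \<in> I \<times> J" using t \<theta> by simp
    interpret R: adapted pp pm p q "?v1 \<theta>" "?e1 \<theta>" "?v2 t" "?e2 t" \<kappa>\<^sub>1 \<kappa>\<^sub>2
      by (rule adapted_rotated)
    note fm = fm_v1[OF \<theta> t] fm_e1[OF \<theta> t] normalized(2)[OF w]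
    note fm' = fm[unfolded lip_commute[of "fm (\<theta>, t)"]]
    have AB: "lip (?v2 t) (fm (\<theta>, t)) = A t" "lip (?e2 t) (fm (\<theta>, t)) = B t"
      by (simp_all add: A_def B_def lip_commute)
    note fp_w = fp[OF \<theta> t] and fp_v_w = fp_v[OF \<theta> t]
    have "lip (fp (\<theta>, t)) (fm (\<theta>, t)) = 0" by (rule iso[OF w fp_\<Lambda>[OF w] fm_\<Lambda>[OF w]])
    then show "d t * A t = \<epsilon> * \<Delta> - \<kappa>\<^sub>1 * C"
      unfolding fp_w using r_nz[OF t] by (simp add: lip_simps lip.minus_left fm' AB algebra_simps)
    have contact: "lip (frechet_derivative fp (at (\<theta>, t)) (0, 1)) g = 0" if "g \<in> \<Lambda> (\<theta>, t)" for g
      by (rule legendre_contact[OF leg w fp_\<Lambda> fp_diff[OF w] that])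
    show "\<kappa>\<^sub>1 * (C / r t) * deriv r t + deriv d t * A t + d t * deriv \<psi> t * B t = 0"
      using contact[OF fm_\<Lambda>[OF w]] unfolding fp_v_w by (simp add: lip_simps fm' AB algebra_simps)
    show "\<kappa>\<^sub>1 * r t * deriv r t + \<kappa>\<^sub>2 * d t * deriv d t = 0"
      using contact[OF fp_\<Lambda>[OF w]] unfolding fp_v_w fp_w
      by (simp add: lip_simps lip.minus_right R.lip_basis algebra_simps)
    have "lip (fp (\<theta>, t)) (fp (\<theta>, t)) = 0" by (rule iso[OF w fp_\<Lambda>[OF w] fp_\<Lambda>[OF w]])
    then show "\<kappa>p * \<Delta> + \<kappa>\<^sub>1 * (r t)\<^sup>2 + \<kappa>\<^sub>2 * (d t)\<^sup>2 = 0"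
      unfolding fp_w constants
      by (simp add: lip_simps lip.minus_right lip.minus_left R.lip_basis algebra_simps power2_eq_square)
    have "lip (fm (\<theta>, t)) (fm (\<theta>, t)) = 0" by (rule iso[OF w fm_\<Lambda>[OF w] fm_\<Lambda>[OF w]])
    moreover have "(\<kappa>\<^sub>1 * (C / r t))\<^sup>2 = (C / r t)\<^sup>2" using \<kappa>_square(1) by algebra
    ultimately show "\<kappa>m * \<Delta> + \<kappa>\<^sub>1 * (C / r t)\<^sup>2 + \<kappa>\<^sub>2 * (A t)\<^sup>2 + (B t)\<^sup>2 = 0"
      using R.lip_square_expansion[of "fm (\<theta>, t)"] fm by (simp add: A_def B_def constants)
    show "\<kappa>\<^sub>1 * (deriv r t)\<^sup>2 + \<kappa>\<^sub>2 * (deriv d t)\<^sup>2 + (d t * deriv \<psi> t)\<^sup>2 \<noteq> 0"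
      using dualD(2)[OF w] unfolding partials(2)[OF fp_diff[OF w]] fp_v_w
      by (simp add: lip_simps R.lip_basis algebra_simps power2_eq_square)
  qed

  \<comment> \<open>The tangent as a multiple of the cross product\<close>
  define D where "D = \<kappa>\<^sub>1 * \<kappa>\<^sub>2 * \<Delta> ^ 3"
  have "D = (\<kappa>\<^sub>1 * \<kappa>\<^sub>2 * \<Delta>) * \<Delta>\<^sup>2" by (simp add: D_def power2_eq_square power3_eq_cube)
  then have D_pos: "D > 0" using sign \<Delta>_nz by simp
  define N\<^sub>1 N\<^sub>2 N\<^sub>3 where "N\<^sub>1 t = \<kappa>\<^sub>2 * d t * B t" and "N\<^sub>2 t = - \<kappa>\<^sub>1 * r t * B t"
    and "N\<^sub>3 t = \<kappa>\<^sub>1 * \<kappa>\<^sub>2 * (\<kappa>\<^sub>2 * r t * A t - d t * (C / r t))" for t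
  define \<mu> where "\<mu> t = (\<kappa>\<^sub>1 * deriv r t * N\<^sub>1 t + \<kappa>\<^sub>2 * deriv d t * N\<^sub>2 t
    + d t * deriv \<psi> t * N\<^sub>3 t) / D" for t
  \<comment> \<open>The square length of the profile tangent. Unlike \<open>\<mu>\<close> it is free
    of \<open>A\<close> and \<open>B\<close>, hence visibly smooth, and it determines |mu|.\<close>
  define Q where "Q t = \<kappa>\<^sub>1 * (deriv r t)\<^sup>2 + \<kappa>\<^sub>2 * (deriv d t)\<^sup>2 + (d t * deriv \<psi> t)\<^sup>2" for t
  have tangent: "deriv r t = \<mu> t * N\<^sub>1 t" "d t * deriv \<psi> t = \<mu> t * N\<^sub>3 t" "Q t = (\<mu> t)\<^sup>2 * D"
    if t: "t \<in> J" for t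
  proof -
    have "d t * A t = \<epsilon> * \<Delta> - \<kappa>\<^sub>1 * (C / r t) * r t"
      using h1[OF t] r_nz[OF t] by simp
    note * = profile_tangent[OF \<kappa>_square constants(4) \<Delta>_nz this h2[OF t] h3[OF t] h4[OF t] h5[OF t]
        N\<^sub>1_def N\<^sub>2_def N\<^sub>3_def \<mu>_def[unfolded D_def], folded D_def Q_def]
    show "deriv r t = \<mu> t * N\<^sub>1 t" by (rule *(1))
    show "d t * deriv \<psi> t = \<mu> t * N\<^sub>3 t" by (rule *(3))
    show "Q t = (\<mu> t)\<^sup>2 * D" by (rule *(4))
  qed
  have \<mu>_nz: "\<mu> t \<noteq> 0" if "t \<in> J" for t
    using tangent(3)[OF that] speed[OF that] unfolding Q_def by auto
  have Q_pos: "Q t > 0" if "t \<in> J" for t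
    using tangent(3)[OF that] \<mu>_nz[OF that] D_pos by simp
  have \<mu>_abs: "\<bar>\<mu> t\<bar> = sqrt (Q t / D)" if "t \<in> J" for t
    using tangent(3)[OF that] D_pos by simp

  \<comment> \<open>A continuous function without zeros on an interval has constant sign; this gives
    one sign for the whole curve.\<close>
  obtain \<sigma> where \<sigma>: "\<sigma> \<in> {1, -1}" "\<And>t. t \<in> J \<Longrightarrow> \<mu> t = \<sigma> * \<bar>\<mu> t\<bar>"
  proof -
    have "continuous_on (I \<times> J) fm"
      using lifts(2) by (simp add: lift_def smooth_on_continuous)
    then have fmc: "continuous_on J (\<lambda>t. fm (\<theta>, t))"
      by (rule continuous_on_compose2) (use \<theta> in \<open>auto intro!: continuous_intros\<close>)
    have "continuous_on UNIV (rot_v \<kappa>\<^sub>2 v\<^sub>2 e\<^sub>2)" "continuous_on UNIV (rot_e \<kappa>\<^sub>2 v\<^sub>2 e\<^sub>2)"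
      using rot_v_deriv[OF \<kappa>_cases(2)] rot_e_deriv[OF \<kappa>_cases(2)]
      by (meson continuous_at_imp_continuous_on has_vector_derivative_continuous)+
    then have "continuous_on J ?v2" "continuous_on J ?e2"
      using smooth_on_continuous[OF smooth(2)] by (auto intro: continuous_on_compose2)
    then have "continuous_on J A" "continuous_on J B"
      unfolding A_def[abs_def] B_def[abs_def] using fmc by (auto intro: lip.continuous_on)
    moreover note smooth_on_continuous[OF smooth(1)] smooth_on_continuous[OF smooth(3)]
      smooth_on_continuous[OF smooth_on_deriv[OF IJ(2) smooth(1)]] smooth_on_continuous[OF smooth_on_deriv[OF IJ(2) smooth(2)]]
      smooth_on_continuous[OF smooth_on_deriv[OF IJ(2) smooth(3)]]
    ultimately have "continuous_on J \<mu>"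
      unfolding \<mu>_def[abs_def] N\<^sub>1_def N\<^sub>2_def N\<^sub>3_def using r_nz D_pos
      by (intro continuous_intros) auto
    then have im: "is_interval (\<mu> ` J)"
      using connected_continuous_image IJ(3) is_interval_connected_1 by blast
    obtain t\<^sub>0 where t\<^sub>0: "t\<^sub>0 \<in> J" using IJ(5) by blast
    have "sgn (\<mu> t) = sgn (\<mu> t\<^sub>0)" if "t \<in> J" for t
    proof (rule ccontr)
      assume "sgn (\<mu> t) \<noteq> sgn (\<mu> t\<^sub>0)"
      then have "\<mu> t \<le> 0 \<and> 0 \<le> \<mu> t\<^sub>0 \<or> \<mu> t\<^sub>0 \<le> 0 \<and> 0 \<le> \<mu> t"
        by (auto simp: sgn_if split: if_splits)
      then have "0 \<in> \<mu> ` J"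
        using im that t\<^sub>0 unfolding is_interval_1 by blast
      then show False using \<mu>_nz by auto
    qed
    then have "\<mu> t = sgn (\<mu> t\<^sub>0) * \<bar>\<mu> t\<bar>" if "t \<in> J" for t
      using that by (metis sgn_mult_abs)
    moreover have "sgn (\<mu> t\<^sub>0) \<in> {1, -1}" using \<mu>_nz[OF t\<^sub>0] by (simp add: sgn_if)
    ultimately show ?thesis using that by blast
  qed

  text \<open>The parameter sought is conformal: with \<open>|k| = 1 / sqrt D\<close> it satisfies
    \<open>|s\<^sup>+\<^sub>t|\<^sup>2 = r\<^sup>2 = |s\<^sup>+\<^sub>\<theta>|\<^sup>2\<close>. The sign of \<open>k\<close> makes \<open>\<sigma>\<close> the sign in the equation for \<open>\<psi>'\<close>.\<close>
  define k where "k = - (\<kappa>\<^sub>1 * \<kappa>\<^sub>2) * sqrt (\<kappa>\<^sub>1 * \<kappa>\<^sub>2 / \<Delta>) / \<Delta>"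
  have "\<kappa>\<^sub>1 * \<kappa>\<^sub>2 / \<Delta> = (\<kappa>\<^sub>1 * \<kappa>\<^sub>2 * \<Delta>) / \<Delta>\<^sup>2" by (simp add: power2_eq_square)
  then have sq_pos: "\<kappa>\<^sub>1 * \<kappa>\<^sub>2 / \<Delta> > 0" using sign \<Delta>_nz by simp
  then have sqrt2: "(sqrt (\<kappa>\<^sub>1 * \<kappa>\<^sub>2 / \<Delta>))\<^sup>2 * \<Delta> = \<kappa>\<^sub>1 * \<kappa>\<^sub>2" using \<Delta>_nz by simp
  have k\<Delta>: "k * \<Delta> = - (\<kappa>\<^sub>1 * \<kappa>\<^sub>2) * sqrt (\<kappa>\<^sub>1 * \<kappa>\<^sub>2 / \<Delta>)" using \<Delta>_nz by (simp add: k_def)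
  have k2: "k\<^sup>2 * \<Delta> ^ 3 = \<kappa>\<^sub>1 * \<kappa>\<^sub>2" using k\<Delta> sqrt2 \<kappa>_square by algebra
  have k_nz: "k \<noteq> 0" using k2 \<kappa>_square by auto

  \<comment> \<open>The power equals 1/|mu|; since \<open>Q\<close> is positive, this form of
    \<open>k * r / |\<mu>|\<close> is smooth.\<close>
  define g where "g t = k * (r t * (1 / D * Q t) powr (- (1 / 2)))" for t
  have g: "g t = k * r t / \<bar>\<mu> t\<bar>" if "t \<in> J" for t
  proof -
    have "(1 / D * Q t) powr (- (1 / 2)) = 1 / \<bar>\<mu> t\<bar>"
      using Q_pos[OF that] D_pos by (simp add: \<mu>_abs[OF that] powr_minus_divide powr_half_sqrt)
    then show ?thesis by (simp add: g_def)
  qed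
  note sm_mult = smooth_on_mult[OF IJ(2)]
  have sq: "smooth_on J (\<lambda>t. (f t)\<^sup>2)" if "smooth_on J f" for f :: "real \<Rightarrow> real"
    using sm_mult[OF that that] by (simp add: power2_eq_square)
  note sm_deriv = smooth_on_deriv[OF IJ(2)]
  have "smooth_on J Q"
    unfolding Q_def[abs_def]
    by (rule smooth_on_add[OF IJ(2) smooth_on_add[OF IJ(2)
          sm_mult[OF smooth_on_const sq[OF sm_deriv[OF smooth(1)]]]
          sm_mult[OF smooth_on_const sq[OF sm_deriv[OF smooth(3)]]]]
          sq[OF sm_mult[OF smooth(3) sm_deriv[OF smooth(2)]]]])
  then have "smooth_on J (\<lambda>t. 1 / D * Q t)"
    by (rule sm_mult[OF smooth_on_const])
  then have "smooth_on J (\<lambda>t. (1 / D * Q t) powr (- (1 / 2)))"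
    by (rule smooth_on_compose[OF IJ(2) open_greaterThan _ smooth_on_powr, rotated])
      (use Q_pos D_pos in auto)
  then have "smooth_on J g"
    unfolding g_def[abs_def] by (rule sm_mult[OF smooth_on_const sm_mult[OF smooth(1)]])
  moreover have "g t \<noteq> 0" if "t \<in> J" for t
    using g[OF that] k_nz r_nz[OF that] \<mu>_nz[OF that] by simp
  ultimately obtain J' \<phi> where rep: "reparametrization J' J \<phi>"
    and \<phi>: "\<And>\<tau>. \<tau> \<in> J' \<Longrightarrow> (\<phi> has_real_derivative g (\<phi> \<tau>)) (at \<tau>)"
    using reparametrization_exists[OF intervals(2)] by blast

  \<comment> \<open>Reality of the roots and the equations in the new parameter\<close>
  let ?p = "\<lambda>x. poly (profile_poly \<kappa>p \<kappa>m \<epsilon> \<Delta> \<kappa>\<^sub>1 C) x"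
  have poly_roots: "complex_of_real (?p x) = of_real (\<kappa>\<^sub>1 * \<kappa>m) * (of_real x - C\<^sub>1) * (of_real x - C\<^sub>2)" for x
    using arg_cong[OF roots, of "\<lambda>p. poly p (of_real x)"]
    by (simp add: profile_poly_def map_poly_pCons algebra_simps)
  have eqs: "(r t * d t * B t)\<^sup>2 = \<kappa>\<^sub>2 * \<Delta> * ?p ((r t)\<^sup>2)"
    "r t * d t * N\<^sub>3 t = \<kappa>\<^sub>1 * \<Delta> * (\<epsilon> * (r t)\<^sup>2 + \<kappa>p * C)" if "t \<in> J" for t
    using profile_equations[OF \<kappa>_square constants(4) r_nz[OF that] h1[OF that] h3[OF that] h4[OF that]]
    unfolding N\<^sub>3_def by blast+

  have "C\<^sub>1 \<in> \<real> \<and> C\<^sub>2 \<in> \<real>" if not_pos: "\<not> (\<kappa>p > 0 \<and> \<kappa>m > 0)"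
  proof -
    \<comment> \<open>The sample point is 0 if \<open>\<kappa>m > 0\<close>, where the constant term
      has the right sign because \<open>\<kappa>p \<le> 0\<close>. Otherwise it is a value of
      \<open>r\<close> squared, where \<open>\<kappa>\<^sub>2 * \<Delta>\<close> times p_C is a
      square.\<close>
    have "\<exists>x. (\<kappa>\<^sub>1 * \<kappa>m) * ?p x \<le> 0"
    proof (cases "\<kappa>m > 0")
      case True
      then have "\<kappa>m * \<kappa>p * C\<^sup>2 \<le> 0" using not_pos by (simp add: mult_le_0_iff)
      moreover have "(\<kappa>\<^sub>1 * \<kappa>m) * ?p 0 = \<kappa>m * \<kappa>p * C\<^sup>2"
        unfolding profile_poly_def using \<kappa>_square(1) by simp
      ultimately show ?thesis by metis
    next
      case False
      obtain t where t: "t \<in> J" using IJ(5) by blast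
      have "(\<kappa>\<^sub>1 * \<kappa>m) * ?p ((r t)\<^sup>2) * (\<kappa>\<^sub>1 * \<kappa>\<^sub>2 * \<Delta>) = \<kappa>m * (r t * d t * B t)\<^sup>2"
        using eqs(1)[OF t] \<kappa>_square by algebra
      also have "\<dots> \<le> 0" using False by (simp add: mult_le_0_iff)
      finally have "(\<kappa>\<^sub>1 * \<kappa>m) * ?p ((r t)\<^sup>2) \<le> 0"
        using sign by (meson mult_pos_pos not_le)
      then show ?thesis by blast
    qed
    then obtain x where x: "(\<kappa>\<^sub>1 * \<kappa>m) * ?p x \<le> 0" by blast
    have nz: "\<kappa>\<^sub>1 * \<kappa>m \<noteq> 0" using \<kappa>_square \<kappa>m_nonzero by auto
    have "z \<in> \<real>" if "z \<in> {C\<^sub>1, C\<^sub>2}" for z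
    proof (rule real_roots[OF nz])
      show "\<kappa>\<^sub>1 * \<kappa>m * (\<kappa>\<^sub>1 * \<kappa>m * x\<^sup>2 + (\<Delta>\<^sup>2 + 2 * \<kappa>\<^sub>1 * \<epsilon> * C) * x + \<kappa>\<^sub>1 * \<kappa>p * C\<^sup>2) \<le> 0"
        using x by (simp add: profile_poly_def algebra_simps power2_eq_square)
      show "complex_of_real (\<kappa>\<^sub>1 * \<kappa>m) * z\<^sup>2 + of_real (\<Delta>\<^sup>2 + 2 * \<kappa>\<^sub>1 * \<epsilon> * C) * z + of_real (\<kappa>\<^sub>1 * \<kappa>p * C\<^sup>2) = 0"
        using arg_cong[OF roots, of "\<lambda>p. poly p z"] that
        by (auto simp: profile_poly_def map_poly_pCons algebra_simps power2_eq_square)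
    qed
    then show ?thesis by simp
  qed
  moreover have
    "complex_of_real ((deriv (r \<circ> \<phi>) \<tau>)\<^sup>2)
        = of_real (\<kappa>m / \<Delta>\<^sup>2) * (of_real ((r (\<phi> \<tau>))\<^sup>2) - C\<^sub>1) * (of_real ((r (\<phi> \<tau>))\<^sup>2) - C\<^sub>2) \<and>
      (\<kappa>p * \<Delta> + \<kappa>\<^sub>1 * (r (\<phi> \<tau>))\<^sup>2 \<noteq> 0 \<longrightarrow>
        deriv (\<psi> \<circ> \<phi>) \<tau>
          = \<sigma> * (sqrt (\<kappa>\<^sub>1 * \<kappa>\<^sub>2 / \<Delta>)
              * ((\<epsilon> * (r (\<phi> \<tau>))\<^sup>2 + \<kappa>p * C) / (\<kappa>p * \<Delta> + \<kappa>\<^sub>1 * (r (\<phi> \<tau>))\<^sup>2)))) \<and>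
      (d (\<phi> \<tau>))\<^sup>2 = - (\<kappa>p * \<Delta> + \<kappa>\<^sub>1 * (r (\<phi> \<tau>))\<^sup>2) / \<kappa>\<^sub>2" if \<tau>: "\<tau> \<in> J'" for \<tau>
  proof (intro conjI impI)
    let ?t = "\<phi> \<tau>"
    have t: "?t \<in> J" using rep \<tau> by (auto simp: reparametrization_def bij_betw_def)
    have chain: "deriv (f \<circ> \<phi>) \<tau> = deriv f ?t * g ?t" if "(f has_real_derivative deriv f ?t) (at ?t)" for f
      using DERIV_imp_deriv[OF DERIV_chain[OF that \<phi>[OF \<tau>]]] .
    \<comment> \<open>By the chain rule the new parameter replaces the unknown factor
      \<open>\<mu>\<close> of the tangent by the explicit \<open>\<sigma> * (k * r)\<close>.\<close>
    have \<mu>g: "\<mu> ?t * g ?t = \<sigma> * (k * r ?t)"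
    proof -
      have "\<bar>\<mu> ?t\<bar> * g ?t = k * r ?t" using g[OF t] \<mu>_nz[OF t] by simp
      then show ?thesis using \<sigma>(2)[OF t] by (metis mult.assoc)
    qed
    have \<sigma>2: "\<sigma> * \<sigma> = 1" using \<sigma>(1) by auto
    have "deriv (r \<circ> \<phi>) \<tau> = \<sigma> * (k * r ?t) * N\<^sub>1 ?t"
      using chain[OF DERIVs(1)[OF t]] tangent(1)[OF t] \<mu>g by algebra
    then have "(deriv (r \<circ> \<phi>) \<tau>)\<^sup>2 * \<Delta> ^ 3 = (k\<^sup>2 * \<Delta> ^ 3) * (r ?t * d ?t * B ?t)\<^sup>2"
      unfolding N\<^sub>1_def using \<sigma>2 \<kappa>_square by algebra
    also have "\<dots> = (\<kappa>\<^sub>1 * ?p ((r ?t)\<^sup>2)) * \<Delta>"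
      unfolding k2 eqs(1)[OF t] using \<kappa>_square by algebra
    finally have "((deriv (r \<circ> \<phi>) \<tau>)\<^sup>2 * \<Delta>\<^sup>2 - \<kappa>\<^sub>1 * ?p ((r ?t)\<^sup>2)) * \<Delta> = 0" by algebra
    then have "(deriv (r \<circ> \<phi>) \<tau>)\<^sup>2 = \<kappa>\<^sub>1 * ?p ((r ?t)\<^sup>2) / \<Delta>\<^sup>2" using \<Delta>_nz by (simp add: field_simps)
    then have "complex_of_real ((deriv (r \<circ> \<phi>) \<tau>)\<^sup>2) = of_real (\<kappa>\<^sub>1 / \<Delta>\<^sup>2) * of_real (?p ((r ?t)\<^sup>2))"
      by simp
    also have "\<dots> = of_real (\<kappa>\<^sub>1 / \<Delta>\<^sup>2 * (\<kappa>\<^sub>1 * \<kappa>m)) * (of_real ((r ?t)\<^sup>2) - C\<^sub>1) * (of_real ((r ?t)\<^sup>2) - C\<^sub>2)"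
      unfolding poly_roots by (simp only: of_real_mult mult.assoc)
    also have "\<kappa>\<^sub>1 / \<Delta>\<^sup>2 * (\<kappa>\<^sub>1 * \<kappa>m) = \<kappa>m / \<Delta>\<^sup>2" using \<kappa>_cases(1) by auto
    finally show "complex_of_real ((deriv (r \<circ> \<phi>) \<tau>)\<^sup>2)
      = of_real (\<kappa>m / \<Delta>\<^sup>2) * (of_real ((r ?t)\<^sup>2) - C\<^sub>1) * (of_real ((r ?t)\<^sup>2) - C\<^sub>2)" .
    show "(d ?t)\<^sup>2 = - (\<kappa>p * \<Delta> + \<kappa>\<^sub>1 * (r ?t)\<^sup>2) / \<kappa>\<^sub>2"
      using h4[OF t] \<kappa>_cases(2) by auto
    assume nz: "\<kappa>p * \<Delta> + \<kappa>\<^sub>1 * (r ?t)\<^sup>2 \<noteq> 0"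
    \<comment> \<open>The tangent determines only \<open>d\<close> times the derivative of
      \<open>\<psi>\<close>. Another factor \<open>d\<close> makes the coefficient a square, which
      \<open>h4\<close> identifies with the denominator up to the factor
      \<open>- \<kappa>\<^sub>2\<close>; \<open>nz\<close> excludes exactly the zeros of
      \<open>d\<close>.\<close>
    have "(d ?t)\<^sup>2 * deriv (\<psi> \<circ> \<phi>) \<tau> = \<sigma> * k * (r ?t * d ?t * N\<^sub>3 ?t)"
      using chain[OF DERIVs(2)[OF t]] tangent(2)[OF t] \<mu>g by algebra
    then have "deriv (\<psi> \<circ> \<phi>) \<tau> * (\<kappa>p * \<Delta> + \<kappa>\<^sub>1 * (r ?t)\<^sup>2)
      = \<sigma> * (sqrt (\<kappa>\<^sub>1 * \<kappa>\<^sub>2 / \<Delta>) * (\<epsilon> * (r ?t)\<^sup>2 + \<kappa>p * C))"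
      using eqs(2)[OF t] h4[OF t] k\<Delta> \<kappa>_square by algebra
    then show "deriv (\<psi> \<circ> \<phi>) \<tau> = \<sigma> * (sqrt (\<kappa>\<^sub>1 * \<kappa>\<^sub>2 / \<Delta>)
        * ((\<epsilon> * (r ?t)\<^sup>2 + \<kappa>p * C) / (\<kappa>p * \<Delta> + \<kappa>\<^sub>1 * (r ?t)\<^sup>2)))"
      using nz by (simp add: eq_divide_eq)
  qed
  ultimately show ?thesis using rep \<sigma>(1) by blast
qed

end
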